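(* Let $f$ be a polynomial of the form $f(z)=z+az^{m+1}+(\text{higher order terms})$ with $m\ge 1$ an integer and $a\in\mathbb{C}$, $a\ne 0$. Let $\mathbf{v}_j$ be an attraction vector of $f$ at $0$, let $\mathcal{A}_j=\mathcal{A}(0,\mathbf{v}_j)$ be the associated parabolic basin of attraction, let $\Omega_j$ be the immediate basin of $\mathcal{A}_j$, and let $\mathcal{P}_j$ be an attracting petal for $f$ for the vector $\mathbf{v}_j$ at $0$. Let $C>0$ be an arbitrary constant and let $q\in\mathcal{P}_j$ be a point lying on the ray $\{t\mathbf{v}_j:t>0\}$. Then there exists a point $z_0\in\Omega_j$ such that for every $$\tilde q\in Q:=\Big(\bigcup_{l,k\ge 0} f^{-l}\big(f^{k}(q)\big)\Big)\cap\Omega_j ,$$ where $l,k$ range over the non-negative integers, the Kobayashi distance satisfies $d_{\Omega_j}(z_0,\tilde q)\ge C$.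
   Context: $f^k$ denotes the $k$-fold iterate of $f$ and $f^{-l}(w)=\{z\in\mathbb{C}: f^l(z)=w\}$ (with $f^0=\mathrm{id}$). Attraction vector: a complex number $\mathbf{v}$ is an attraction vector of $f$ at $0$ if $ma\mathbf{v}^m=-1$; there are $m$ of them. Parabolic basin: $\mathcal{A}(0,\mathbf{v}_j)$ is the set of all $z_0\in\mathbb{C}$ whose orbit $z_k=f^k(z_0)$ converges to $0$ with no $z_k$ equal to $0$, and from the direction $\mathbf{v}_j$, i.e. $z_k\sim \mathbf{v}_j/\sqrt[m]{k}$ as $k\to\infty$ (that is, $\lim_{k\to\infty}\sqrt[m]{k}\,z_k=\mathbf{v}_j$). Immediate basin: $\Omega_j$ is the unique connected component of $\mathcal{A}_j$ that is mapped into itself by $f$. Attracting petal: let $N$ be a neighborhood of $0$ on which $f$ is univalent. An open set $\mathcal{P}_j\subset N$ is an attracting petal for $f$ for the vector $\mathbf{v}_j$ at $0$ if (1) $f(\mathcal{P}_j)\subset\mathcal{P}_j$, and (2) an orbit $z_0\mapsto z_1\mapsto\cdots$ under $f$ is eventually absorbed by $\mathcal{P}_j$ if and only if it converges to $0$ from the direction $\mathbf{v}_j$. Kobayashi metric and distance: let $\Delta$ be the open unit disk. For a domain $\Omega\subset\mathbb{C}$, $z\in\Omega$ and $\xi\in\mathbb{C}$, put $F_\Omega(z,\xi)=\inf\{\lambda>0:\ \exists\, g:\Delta\to\Omega \text{ holomorphic with } g(0)=z,\ \lambda g'(0)=\xi\}$. The length of a piecewise smooth curve $\gamma:[0,1]\to\Omega$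 is $L_\Omega(\gamma)=\int_0^1F_\Omega(\gamma(t),\gamma'(t))\,dt$, and $d_\Omega(z_1,z_2)=\inf L_\Omega(\gamma)$ over piecewise smooth curves $\gamma$ in $\Omega$ joining $z_1$ to $z_2$. *)

theory Defs
  imports
    "HOL-Complex_Analysis.Complex_Analysis"
    "HOL-Computational_Algebra.Polynomial"
begin

definition attraction_vector :: "nat \<Rightarrow> complex \<Rightarrow> complex \<Rightarrow> bool" where
  "attraction_vector m a v \<longleftrightarrow> of_nat m * a * v ^ m = -1"

definition converges_from_direction :: "nat \<Rightarrow> complex \<Rightarrow> (nat \<Rightarrow> complex) \<Rightarrow> bool" where
  "converges_from_direction m v z \<longleftrightarrow>
     z \<longlonglongrightarrow> 0 \<and> (\<forall>k. z k \<noteq> 0) \<and>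
     (\<lambda>k. of_real (root m (real k)) * z k) \<longlonglongrightarrow> v"

definition parabolic_basin :: "(complex \<Rightarrow> complex) \<Rightarrow> nat \<Rightarrow> complex \<Rightarrow> complex set" where
  "parabolic_basin f m v = {z0. converges_from_direction m v (\<lambda>k. (f ^^ k) z0)}"

(* Stated as a predicate on U, so that no appeal to uniqueness of the invariant component
   is built in: a theorem about every immediate basin covers "the" immediate basin. *)
definition is_immediate_basin ::
    "(complex \<Rightarrow> complex) \<Rightarrow> nat \<Rightarrow> complex \<Rightarrow> complex set \<Rightarrow> bool" where
  "is_immediate_basin f m v U \<longleftrightarrow>
     U \<in> components (parabolic_basin f m v) \<and> f ` U \<subseteq> U"

definition attracting_petal ::
    "(complex \<Rightarrow> complex) \<Rightarrow> nat \<Rightarrow> complex \<Rightarrow> complex set \<Rightarrow> bool" where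
  "attracting_petal f m v P \<longleftrightarrow>
     open P \<and>
     (\<exists>N. open N \<and> 0 \<in> N \<and> f holomorphic_on N \<and> inj_on f N \<and> P \<subseteq> N) \<and>
     f ` P \<subseteq> P \<and>
     (\<forall>z0. (\<exists>K. \<forall>k\<ge>K. (f ^^ k) z0 \<in> P) \<longleftrightarrow>
           converges_from_direction m v (\<lambda>k. (f ^^ k) z0))"

(* For open U and z in U the set below is nonempty, so the real-valued Inf is the true infimum. *)
definition kobayashi_metric :: "complex set \<Rightarrow> complex \<Rightarrow> complex \<Rightarrow> real" where
  "kobayashi_metric U z \<xi> =
     Inf {l. l > 0 \<and> (\<exists>g. g holomorphic_on ball 0 1 \<and> g ` ball 0 1 \<subseteq> U \<and>
                          g 0 = z \<and> of_real l * deriv g 0 = \<xi>)}"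

(* A valid_path may have an unbounded derivative near its finitely many exceptional points, so
   its length may be infinite. The length is therefore taken in ennreal: a real-valued integral
   would silently assign such curves length 0. *)
definition kobayashi_length :: "complex set \<Rightarrow> (real \<Rightarrow> complex) \<Rightarrow> ennreal" where
  "kobayashi_length U \<gamma> =
     (\<integral>\<^sup>+ t\<in>{0..1}. ennreal (kobayashi_metric U (\<gamma> t) (vector_derivative \<gamma> (at t))) \<partial>lborel)"

definition kobayashi_dist :: "complex set \<Rightarrow> complex \<Rightarrow> complex \<Rightarrow> ennreal" where
  "kobayashi_dist U z1 z2 =
     (INF \<gamma> \<in> {\<gamma>. valid_path \<gamma> \<and> path_image \<gamma> \<subseteq> U \<and> pathstart \<gamma> = z1 \<and> pathfinish \<gamma> = z2}.
        kobayashi_length U \<gamma>)"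

definition grand_orbit :: "(complex \<Rightarrow> complex) \<Rightarrow> complex \<Rightarrow> complex set" where
  "grand_orbit f q = (\<Union>l. \<Union>k. (f ^^ l) -` {(f ^^ k) q})"

end

theory Submission imports Defs begin

text \<open>In the coordinate \<open>w = -1 / (m a z\<^bsup>m\<^esup>)\<close> the map is \<open>w \<mapsto> w + 1 + o(1)\<close>. Seen at a large scale \<open>n\<close>, the
  immediate basin looks like the plane slit along the negative axis: it contains the tilted
  half-planes that avoid the slit, while a backward orbit outside the basin fills the slit ever more
  densely. Let \<open>z\<^sub>0\<close> have coordinate about \<open>n (-1 + i m \<eta>)\<close> for a small \<open>\<eta>\<close>. By Schottky's theorem the
  Kobayashi metric near the slit is at least a constant multiple of the inverse height, so leaving a
  fixed neighbourhood of \<open>-n\<close>, or descending to relative height \<open>\<eta>\<^sup>2\<close>, costs a length of order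
  \<open>ln (1 / \<eta>)\<close>. The region so bounded misses the grand orbit of \<open>q\<close>: its points have forward orbits
  staying so close to \<open>0\<close> that, by injectivity of the map there, they could only meet the grand orbit in
  an iterate of \<open>q\<close> of large index, and those lie near the positive axis.\<close>

subsection \<open>Lower bounds for the Kobayashi distance\<close>

text \<open>The constants are chosen in the order \<open>C\<close>, \<open>\<eta>\<close>,
  \<open>n\<close>: the wanted cost fixes \<open>\<eta>\<close>, and only then is \<open>n\<close>
  made so large that the backward orbit fills the slit up to the relative error
  \<open>\<eta>^2 / 10\<close> and that a half-plane tilted by nearly a right angle contains the
  whole region. The lower edge sits at \<open>\<eta>^2\<close> because the logarithm of the height
  then drops by \<open>ln (1 / \<eta>)\<close>, which is, up to a constant, what the logarithm of
  the distance to the centre gains before the arc is reached.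

  The main obstacle is a first point outside the basin near the repelling direction. For
  \<open>m \<ge> 2\<close> a neighbouring basin provides one; for \<open>m = 1\<close> there is only
  one attraction vector, and it must be excluded that a whole punctured neighbourhood of 0 is
  attracted. One such point suffices: the local inverse of \<open>f\<close> has the same form with
  \<open>-a\<close> in place of \<open>a\<close>, so the backward orbit obeys the asymptotics of an
  attracted orbit, and forward invariance of \<open>\<Omega>\<close> keeps it outside
  \<open>\<Omega>\<close>.\<close>

lemma norm_increment_le_nn_integral:
  fixes \<phi> :: "real \<Rightarrow> 'a::euclidean_space"
  assumes "0 \<le> T" "continuous_on {0..T} \<phi>" "finite S"
    and der: "\<And>t. t \<in> {0<..<T} - S \<Longrightarrow> (\<phi> has_vector_derivative D t) (at t)"
  shows "ennreal (norm (\<phi> T - \<phi> 0)) \<le> (\<integral>\<^sup>+t\<in>{0..T}. ennreal (norm (D t)) \<partial>lborel)"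
proof -
  let ?I = "\<integral>\<^sup>+t\<in>{0..T}. ennreal (norm (D t)) \<partial>lborel"
  let ?D = "\<lambda>t. if t \<in> {0..T} then D t else 0"
  \<comment> \<open>The gauge integral accepts a derivative that is unbounded near \<open>S\<close>.
    It also yields measurability of \<open>D\<close>, so a finite integral of the norm makes
    \<open>D\<close> Lebesgue integrable; an infinite one leaves nothing to prove.\<close>
  have ftc: "(D has_integral (\<phi> T - \<phi> 0)) {0..T}"
    by (rule fundamental_theorem_of_calculus_interior_strong [OF \<open>finite S\<close> \<open>0 \<le> T\<close>])
       (use assms in auto)
  then have D: "(?D has_integral (\<phi> T - \<phi> 0)) UNIV"
    by (simp only: has_integral_restrict_UNIV)
  have I: "(\<integral>\<^sup>+t. ennreal (norm (?D t)) \<partial>lebesgue) = ?I"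
    by (subst nn_integral_completion) (auto intro!: nn_integral_cong simp: indicator_def)
  show ?thesis
  proof (cases "?I < \<infinity>")
    case True
    have "?D \<in> borel_measurable lebesgue"
      using has_integral_implies_lebesgue_measurable [OF D] by simp
    with True have int: "integrable lebesgue ?D"
      unfolding I [symmetric] by (intro integrableI_bounded) simp_all
    have "\<phi> T - \<phi> 0 = integral\<^sup>L lebesgue ?D"
      using has_integral_unique [OF D has_integral_integral_lebesgue [OF int]] .
    with integral_norm_bound_ennreal [OF int] I show ?thesis
      by simp
  next
    case False
    then have "?I = \<infinity>" by (metis top.not_eq_extremum infinity_ennreal_def)
    then show ?thesis by simp
  qed
qed

text \<open>Curves are followed only up to the time \<open>T\<close> at which they leave a region
  where the metric is controlled; the remainder can only add length. The metric inequality is asked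
  on the open interval because the exit point lies outside that region, and single points are null
  sets. The comparison map \<open>G\<close> is used both with real and with complex values.\<close>

lemma kobayashi_length_ge:
  fixes G :: "complex \<Rightarrow> 'a::euclidean_space"
  assumes \<gamma>: "valid_path \<gamma>" and T: "T \<in> {0..1}" and "c > 0"
    and G: "\<And>t. t \<in> {0..T} \<Longrightarrow> (G has_derivative G' (\<gamma> t)) (at (\<gamma> t))"
    and le: "\<And>t \<xi>. t \<in> {0<..<T} \<Longrightarrow> c * norm (G' (\<gamma> t) \<xi>) \<le> kobayashi_metric U (\<gamma> t) \<xi>"
  shows "ennreal (c * norm (G (\<gamma> T) - G (\<gamma> 0))) \<le> kobayashi_length U \<gamma>"
proof -
  obtain S where S: "finite S" "\<gamma> C1_differentiable_on ({0..1} - S)" and cont: "continuous_on {0..1} \<gamma>"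
    using \<gamma> by (auto simp: valid_path_def piecewise_C1_differentiable_on_def)
  let ?D = "\<lambda>t. G' (\<gamma> t) (vector_derivative \<gamma> (at t))"
  have vd: "(\<gamma> has_vector_derivative vector_derivative \<gamma> (at t)) (at t)"
    if "t \<in> {0<..<T} - S" for t
    using S(2) that T by (auto simp: C1_differentiable_on_eq vector_derivative_works)
  have der: "((\<lambda>t. c *\<^sub>R G (\<gamma> t)) has_vector_derivative c *\<^sub>R ?D t) (at t)" if "t \<in> {0<..<T} - S" for t
  proof -
    have "((G \<circ> \<gamma>) has_vector_derivative ?D t) (at t)"
      using vd [OF that] G [of t] that
        vector_derivative_diff_chain_within [of \<gamma> "vector_derivative \<gamma> (at t)" t UNIV G]
      by (auto intro: has_derivative_at_withinI)
    from has_vector_derivative_scaleR [OF DERIV_const [of c] this]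
    show ?thesis by (simp add: o_def)
  qed
  have "continuous_on {0..T} (\<lambda>t. c *\<^sub>R G (\<gamma> t))"
  proof (intro continuous_on_scaleR continuous_on_const)
    have "continuous_on (\<gamma> ` {0..T}) G"
      using G by (intro continuous_at_imp_continuous_on ballI) (blast intro: has_derivative_continuous)
    moreover have "continuous_on {0..T} \<gamma>"
      using cont T by (auto intro: continuous_on_subset)
    ultimately show "continuous_on {0..T} (\<lambda>t. G (\<gamma> t))"
      by (rule continuous_on_compose2) auto
  qed
  from norm_increment_le_nn_integral [OF _ this S(1) der] T \<open>c > 0\<close>
  have "ennreal (c * norm (G (\<gamma> T) - G (\<gamma> 0))) \<le> (\<integral>\<^sup>+t\<in>{0..T}. ennreal (norm (c *\<^sub>R ?D t)) \<partial>lborel)"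
    by (simp add: scaleR_diff_right [symmetric])
  also have "\<dots> \<le> kobayashi_length U \<gamma>"
    unfolding kobayashi_length_def
  proof (rule nn_integral_mono_AE)
    have "AE t in lborel. t \<noteq> 0 \<and> t \<noteq> T"
      by (intro AE_conjI AE_lborel_singleton)
    then show "AE t in lborel. ennreal (norm (c *\<^sub>R ?D t)) * indicator {0..T} t
        \<le> ennreal (kobayashi_metric U (\<gamma> t) (vector_derivative \<gamma> (at t))) * indicator {0..1} t"
      by eventually_elim (use le T \<open>c > 0\<close> in \<open>auto simp: indicator_def intro!: ennreal_leI\<close>)
  qed
  finally show ?thesis .
qed

text \<open>Schottky's theorem bounds \<open>G\<close> on a smaller disc, and Cauchy's inequality
  turns this into a bound for the derivative. The 2 is the ratio between the distances to two
  omitted points that is tolerated later.\<close>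

lemma Landau_bound:
  obtains B :: real where "B > 0"
    "\<And>G. \<lbrakk>G holomorphic_on ball 0 1; \<And>z. z \<in> ball 0 1 \<Longrightarrow> G z \<noteq> 0 \<and> G z \<noteq> 1; norm (G 0) \<le> 2\<rbrakk>
         \<Longrightarrow> norm (deriv G 0) \<le> B"
proof -
  \<comment> \<open>Schottky's constant for initial value at most 2 and radius 1/2. It is applied to
    \<open>G (z / 2)\<close>, which is holomorphic on the closed disc, so it controls
    \<open>G\<close> up to radius 1/4.\<close>
  define E :: real where "E = exp (pi * exp (pi * (2 + 2 * 2 + 12 * (1/2) / (1 - 1/2))))"
  show ?thesis
  proof (rule that [of "4 * E"])
    show "4 * E > 0" by (simp add: E_def)
  next
    fix G :: "complex \<Rightarrow> complex"
    assume hol: "G holomorphic_on ball 0 1" and omit: "\<And>z. z \<in> ball 0 1 \<Longrightarrow> G z \<noteq> 0 \<and> G z \<noteq> 1"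
      and G0: "norm (G 0) \<le> 2"
    have bd: "norm (G z) \<le> E" if "norm z \<le> 1/4" for z
    proof -
      have "norm (G (2 * z / 2)) \<le> E"
        unfolding E_def
      proof (rule Schottky [of "\<lambda>z. G (z / 2)"])
        show "(\<lambda>z. G (z / 2)) holomorphic_on cball 0 1"
          by (rule holomorphic_on_compose_gen [OF _ hol, of "\<lambda>z. z / 2", unfolded o_def])
             (auto intro!: holomorphic_intros)
        show "\<And>z. z \<in> cball 0 1 \<Longrightarrow> \<not> (G (z / 2) = 0 \<or> G (z / 2) = 1)"
          using omit by (simp add: norm_divide)
      qed (use G0 that in \<open>auto simp: norm_mult\<close>)
      then show ?thesis by simp
    qed
    have "norm ((deriv ^^ 1) G 0) \<le> fact 1 * E / (1/4) ^ 1"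
    proof (rule Cauchy_inequality)
      show "continuous_on (cball 0 (1/4)) G"
        by (rule holomorphic_on_imp_continuous_on, rule holomorphic_on_subset [OF hol]) auto
    qed (auto intro!: holomorphic_on_subset [OF hol] bd)
    then show "norm (deriv G 0) \<le> 4 * E" by simp
  qed
qed

text \<open>Two omitted points whose mutual distance is comparable to their distance from \<open>z\<close> replace
  the boundary distance in the usual estimate for simply connected domains.\<close>

lemma kobayashi_metric_lower_bound:
  obtains B :: real where "B > 0"
    "\<And>U z P Q \<xi>. \<lbrakk>open U; z \<in> U; P \<notin> U; Q \<notin> U; P \<noteq> Q; norm (z - P) \<le> 2 * norm (Q - P)\<rbrakk>
       \<Longrightarrow> norm \<xi> \<le> B * norm (Q - P) * kobayashi_metric U z \<xi>"
proof -
  obtain B :: real where B: "B > 0"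
    and Landau: "\<And>G. \<lbrakk>G holomorphic_on ball 0 1; \<And>z. z \<in> ball 0 1 \<Longrightarrow> G z \<noteq> 0 \<and> G z \<noteq> 1;
       norm (G 0) \<le> 2\<rbrakk> \<Longrightarrow> norm (deriv G 0) \<le> B"
    using Landau_bound by metis
  show ?thesis
  proof (rule that [OF B])
    fix U :: "complex set" and z P Q \<xi> :: complex
    assume U: "open U" "z \<in> U" and PQ: "P \<notin> U" "Q \<notin> U" "P \<noteq> Q" "norm (z - P) \<le> 2 * norm (Q - P)"
    let ?X = "{l. l > 0 \<and> (\<exists>g. g holomorphic_on ball 0 1 \<and> g ` ball 0 1 \<subseteq> U \<and>
                          g 0 = z \<and> of_real l * deriv g 0 = \<xi>)}"
    \<comment> \<open>A lower bound for the elements passes to \<open>Inf\<close> only if the set is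
      nonempty. An affine disc in a ball around \<open>z\<close> gives an element;
      \<open>\<xi> = 0\<close> is separate because \<open>l\<close> must be positive.\<close>
    have "?X \<noteq> {}"
    proof -
      obtain r where r: "r > 0" "ball z r \<subseteq> U"
        using U openE by blast
      define l where "l = (if \<xi> = 0 then 1 else norm \<xi> / r)"
      have l: "l > 0" using r by (auto simp: l_def)
      define g where "g = (\<lambda>w::complex. z + w * (\<xi> / of_real l))"
      have "g ` ball 0 1 \<subseteq> ball z r"
      proof (cases "\<xi> = 0")
        case False
        then show ?thesis
          using r by (auto simp: g_def l_def dist_norm norm_mult norm_divide)
      qed (use r in \<open>auto simp: g_def\<close>)
      moreover have "deriv g 0 = \<xi> / of_real l"
        unfolding g_def using l by (intro DERIV_imp_deriv) (auto intro!: derivative_eq_intros)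
      moreover have "g holomorphic_on ball 0 1"
        unfolding g_def by (intro holomorphic_intros) (use l in auto)
      ultimately have "l \<in> ?X"
        using r(2) l by (intro CollectI conjI exI [of _ g]) (auto simp: g_def)
      then show ?thesis by blast
    qed
    moreover have "norm \<xi> / (B * norm (Q - P)) \<le> l" if l: "l \<in> ?X" for l
    proof -
      from l obtain g where g: "g holomorphic_on ball 0 1" "g ` ball 0 1 \<subseteq> U" "g 0 = z"
          "of_real l * deriv g 0 = \<xi>" and "l > 0" by auto
      define G where "G = (\<lambda>w. (g w - P) / (Q - P))"
      have "norm (deriv G 0) \<le> B"
      proof (rule Landau)
        show "G holomorphic_on ball 0 1"
          unfolding G_def using PQ by (intro holomorphic_intros g) auto
        show "G w \<noteq> 0 \<and> G w \<noteq> 1" if "w \<in> ball 0 1" for w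
        proof -
          have "g w \<in> U" using g(2) that by blast
          with PQ show ?thesis by (auto simp: G_def)
        qed
        show "norm (G 0) \<le> 2"
          using PQ g by (simp add: G_def norm_divide field_simps)
      qed
      moreover have "deriv G 0 = deriv g 0 / (Q - P)"
      proof -
        have "(g has_field_derivative deriv g 0) (at 0)"
          by (rule holomorphic_derivI [OF g(1)]) auto
        then show ?thesis
          unfolding G_def by (intro DERIV_imp_deriv DERIV_cdivide) (auto intro!: derivative_eq_intros)
      qed
      ultimately have "norm (deriv g 0) \<le> B * norm (Q - P)"
        using PQ by (simp add: norm_divide field_simps)
      then show ?thesis
        using g(4) \<open>l > 0\<close> B PQ by (auto simp: norm_mult field_simps)
    qed
    ultimately have "norm \<xi> / (B * norm (Q - P)) \<le> kobayashi_metric U z \<xi>"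
      unfolding kobayashi_metric_def by (intro cInf_greatest) auto
    then show "norm \<xi> \<le> B * norm (Q - P) * kobayashi_metric U z \<xi>"
      using B PQ by (simp add: field_simps)
  qed
qed

text \<open>The complement of \<open>U\<close> is dense, relative to the scale \<open>\<eta>\<^sup>2\<close>, along a segment, so the metric
  of \<open>U\<close> near that segment is comparable to that of the upper half-plane. Leaving the region through
  its lower edge is controlled by the logarithm of the height, through its arc by the logarithm of
  the distance to \<open>1\<close>.\<close>

lemma kobayashi_dist_near_dense_complement:
  obtains K :: real where "K > 0"
    "\<And>U \<kappa> b \<eta> z'. \<lbrakk>open U; \<kappa> \<noteq> 0; 0 < \<eta>; \<eta> < b; b \<le> 1/2;
        \<And>t::real. t \<in> {1/2..2} \<Longrightarrow> \<exists>P. P \<notin> U \<and> norm (P / \<kappa> - of_real t) < \<eta>\<^sup>2 / 10;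
        \<not> (norm (z' / \<kappa> - 1) < b \<and> \<eta>\<^sup>2 < Im (z' / \<kappa>))\<rbrakk>
      \<Longrightarrow> ennreal (ln (b / \<eta>) / K) \<le> kobayashi_dist U (\<kappa> * (1 + \<i> * of_real \<eta>)) z'"
proof -
  obtain B :: real where B: "B > 0"
    and metric: "\<And>U z P Q \<xi>. \<lbrakk>open U; z \<in> U; P \<notin> U; Q \<notin> U; P \<noteq> Q; norm (z - P) \<le> 2 * norm (Q - P)\<rbrakk>
       \<Longrightarrow> norm \<xi> \<le> B * norm (Q - P) * kobayashi_metric U z \<xi>"
    using kobayashi_metric_lower_bound by metis
  show ?thesis
  proof (rule that [of "2 * B"])
    show "2 * B > 0" using B by simp
  next
    fix U :: "complex set" and \<kappa> z' :: complex and b \<eta> :: real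
    assume "open U" "\<kappa> \<noteq> 0" "0 < \<eta>" "\<eta> < b" "b \<le> 1/2"
      and dense: "\<And>t::real. t \<in> {1/2..2} \<Longrightarrow> \<exists>P. P \<notin> U \<and> norm (P / \<kappa> - of_real t) < \<eta>\<^sup>2 / 10"
      and z': "\<not> (norm (z' / \<kappa> - 1) < b \<and> \<eta>\<^sup>2 < Im (z' / \<kappa>))"
    define R where "R = {z. norm (z / \<kappa> - 1) < b \<and> \<eta>\<^sup>2 < Im (z / \<kappa>)}"
    define c where "c = 1 / (2 * B)"
    have "c > 0" using B by (simp add: c_def)
    have low: "c * (norm (\<xi> / \<kappa>) / Im (z / \<kappa>)) \<le> kobayashi_metric U z \<xi>" if z: "z \<in> U" "z \<in> R" for z \<xi>
    proof -
      define Z where "Z = z / \<kappa>"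
      define y where "y = Im Z"
      have y: "\<eta>\<^sup>2 < y" "norm (Z - 1) < b" using z by (auto simp: R_def Z_def y_def)
      then have "y > 0" by (smt (verit) zero_le_power2)
      have "y < 1/2" "\<bar>Re Z - 1\<bar> < 1/2"
        using abs_Im_le_cmod [of "Z - 1"] abs_Re_le_cmod [of "Z - 1"] y \<open>b \<le> 1/2\<close>
        by (auto simp: y_def)
      then have "Re Z \<in> {1/2..2}" "Re Z + y \<in> {1/2..2}"
        using \<open>y > 0\<close> unfolding atLeastAtMost_iff by (intro conjI; linarith)+
      \<comment> \<open>Complement points near the foot of \<open>Z\<close> on the real axis and
        near the point at distance \<open>y\<close> to its right. The error is below
        \<open>y / 10\<close> as \<open>Z\<close> lies above height \<open>\<eta>^2\<close>, so
        \<open>P'\<close> and \<open>Q'\<close> are between 0.8 \<open>y\<close> and 1.2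
        \<open>y\<close> apart, and \<open>Z\<close> is within 1.1 \<open>y\<close> of
        \<open>P'\<close>.\<close>
      with dense obtain P Q where PQ: "P \<notin> U" "norm (P / \<kappa> - of_real (Re Z)) < \<eta>\<^sup>2 / 10"
          "Q \<notin> U" "norm (Q / \<kappa> - of_real (Re Z + y)) < \<eta>\<^sup>2 / 10"
        by metis
      define P' Q' where "P' = P / \<kappa>" and "Q' = Q / \<kappa>"
      have PQ': "norm (P' - of_real (Re Z)) < y / 10" "norm (Q' - of_real (Re Z + y)) < y / 10"
        using PQ y by (auto simp: P'_def Q'_def)
      have ny: "norm (complex_of_real y) = y" "norm (\<i> * complex_of_real y) = y"
        using \<open>y > 0\<close> by (auto simp: norm_mult)
      have e1: "Q' - P' = of_real y + ((Q' - of_real (Re Z + y)) - (P' - of_real (Re Z)))"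
        by (simp add: algebra_simps)
      have e2: "Z - P' = \<i> * of_real y - (P' - of_real (Re Z))"
        by (simp add: complex_eq_iff y_def)
      have dQP: "norm (Q' - P') \<le> 12/10 * y" "norm (Q' - P') \<ge> 8/10 * y" "norm (Z - P') \<le> 11/10 * y"
        using PQ' norm_triangle_ineq [of "of_real y" "(Q' - of_real (Re Z + y)) - (P' - of_real (Re Z))"]
          norm_triangle_ineq4 [of "Q' - of_real (Re Z + y)" "P' - of_real (Re Z)"]
          norm_diff_ineq [of "of_real y" "(Q' - of_real (Re Z + y)) - (P' - of_real (Re Z))"]
          norm_triangle_ineq4 [of "\<i> * of_real y" "P' - of_real (Re Z)"] ny
        unfolding e1 [symmetric] e2 [symmetric] by linarith+
      have n: "norm (Q - P) = norm \<kappa> * norm (Q' - P')" "norm (z - P) = norm \<kappa> * norm (Z - P')"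
        using \<open>\<kappa> \<noteq> 0\<close> by (simp_all add: P'_def Q'_def Z_def norm_mult [symmetric] algebra_simps)
      have ne: "norm (Q - P) > 0"
        unfolding n using dQP \<open>y > 0\<close> \<open>\<kappa> \<noteq> 0\<close> by (intro mult_pos_pos) auto
      have "norm (z - P) \<le> 2 * norm (Q - P)"
        unfolding n using dQP \<open>y > 0\<close> by (simp add: mult.left_commute mult_left_mono)
      with metric [OF \<open>open U\<close> z(1) PQ(1,3)] ne
      have m: "norm \<xi> \<le> B * norm (Q - P) * kobayashi_metric U z \<xi>" by auto
      have F: "kobayashi_metric U z \<xi> \<ge> 0"
      proof (rule ccontr)
        assume "\<not> ?thesis"
        then have "B * norm (Q - P) * kobayashi_metric U z \<xi> < 0"
          using B ne by (intro mult_pos_neg) auto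
        with m show False by (smt (verit) norm_ge_zero)
      qed
      have "norm (Q - P) \<le> norm \<kappa> * (2 * y)"
        unfolding n using dQP \<open>y > 0\<close> by (intro mult_left_mono) auto
      with F B have "B * norm (Q - P) * kobayashi_metric U z \<xi> \<le> B * (norm \<kappa> * (2 * y)) * kobayashi_metric U z \<xi>"
        by (intro mult_right_mono mult_left_mono) auto
      with m have "norm \<xi> \<le> B * (norm \<kappa> * (2 * y)) * kobayashi_metric U z \<xi>" by linarith
      then show ?thesis
        using B \<open>y > 0\<close> \<open>\<kappa> \<noteq> 0\<close>
        by (simp add: c_def norm_divide field_simps flip: Z_def y_def)
    qed
    show "ennreal (ln (b / \<eta>) / (2 * B)) \<le> kobayashi_dist U (\<kappa> * (1 + \<i> * of_real \<eta>)) z'"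
      unfolding kobayashi_dist_def
    proof (rule INF_greatest)
      fix \<gamma> assume "\<gamma> \<in> {\<gamma>. valid_path \<gamma> \<and> path_image \<gamma> \<subseteq> U \<and>
        pathstart \<gamma> = \<kappa> * (1 + \<i> * of_real \<eta>) \<and> pathfinish \<gamma> = z'}"
      then have \<gamma>: "valid_path \<gamma>" "path_image \<gamma> \<subseteq> U" "\<gamma> 0 = \<kappa> * (1 + \<i> * of_real \<eta>)" "\<gamma> 1 = z'"
        by (auto simp: pathstart_def pathfinish_def)
      have cont: "continuous_on {0..1} \<gamma>"
        using valid_path_imp_path [OF \<gamma>(1)] by (simp add: path_def)
      have "open R"
        unfolding R_def using \<open>\<kappa> \<noteq> 0\<close>
        by (intro open_Collect_conj open_Collect_less continuous_intros) auto
      \<comment> \<open>The times outside the open region \<open>R\<close> form a closed set, so its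
        infimum is attained: it is the first exit time.\<close>
      define S where "S = {0..1} \<inter> \<gamma> -` (- R)"
      have "closed S"
        unfolding S_def using cont \<open>open R\<close> by (intro continuous_closed_preimage) auto
      have "1 \<in> S" using \<gamma> z' by (auto simp: S_def R_def)
      have "bdd_below S" unfolding S_def by (auto intro: bdd_belowI [of _ 0])
      define T where "T = Inf S"
      have "T \<in> S"
        unfolding T_def using \<open>1 \<in> S\<close> \<open>closed S\<close> \<open>bdd_below S\<close> by (intro closed_contains_Inf) auto
      then have T: "T \<in> {0..1}" "\<gamma> T \<notin> R" by (auto simp: S_def)
      have before: "\<gamma> t \<in> R" if "0 \<le> t" "t < T" for t
        using that T(1) cInf_lower [OF _ \<open>bdd_below S\<close>, of t] by (force simp: S_def T_def)
      have start: "\<gamma> 0 / \<kappa> = 1 + \<i> * of_real \<eta>" using \<gamma> \<open>\<kappa> \<noteq> 0\<close> by simp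
      have "\<eta>\<^sup>2 < \<eta>" using \<open>0 < \<eta>\<close> \<open>\<eta> < b\<close> \<open>b \<le> 1/2\<close> by (simp add: power2_eq_square)
      then have "\<gamma> 0 \<in> R"
        unfolding R_def using \<open>0 < \<eta>\<close> \<open>\<eta> < b\<close> by (simp add: start norm_mult)
      with T have "T > 0" by (metis atLeastAtMost_iff order_le_less)
      have contT: "continuous_on (closure {0..<T}) \<gamma>"
        using \<open>T > 0\<close> T cont by (auto intro: continuous_on_subset)
      have "T \<in> closure {0..<T}" using \<open>T > 0\<close> by simp
      have TIm: "\<eta>\<^sup>2 \<le> Im (\<gamma> T / \<kappa>)"
        by (rule continuous_ge_on_closure [OF _ \<open>T \<in> closure {0..<T}\<close>])
           (use before \<open>\<kappa> \<noteq> 0\<close> in \<open>force simp: R_def intro!: continuous_intros contT\<close>)+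
      have Tn: "norm (\<gamma> T / \<kappa> - 1) \<le> b"
        by (rule continuous_le_on_closure [OF _ \<open>T \<in> closure {0..<T}\<close>])
           (use before \<open>\<kappa> \<noteq> 0\<close> in \<open>force simp: R_def intro!: continuous_intros contT\<close>)+
      have pos: "Im (\<gamma> t / \<kappa>) > 0" if "t \<in> {0..T}" for t
      proof -
        have "Im (\<gamma> t / \<kappa>) \<ge> \<eta>\<^sup>2"
          using that before [of t] TIm by (cases "t = T") (auto simp: R_def)
        then show ?thesis using \<open>0 < \<eta>\<close> by (smt (verit) zero_less_power)
      qed
      have inU: "\<gamma> t \<in> U" if "t \<in> {0<..<T}" for t
        using \<gamma>(2) that T by (auto simp: path_image_def)
      have "Im (\<gamma> T / \<kappa>) = \<eta>\<^sup>2 \<or> norm (\<gamma> T / \<kappa> - 1) = b"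
        using T TIm Tn by (auto simp: R_def)
      then have "ennreal (c * ln (b / \<eta>)) \<le> kobayashi_length U \<gamma>"
      proof
        assume Im: "Im (\<gamma> T / \<kappa>) = \<eta>\<^sup>2"
        define G where "G = (\<lambda>z. ln (Im (z / \<kappa>)))"
        define G' where "G' = (\<lambda>z \<xi>. Im (\<xi> / \<kappa>) / Im (z / \<kappa>))"
        have "ennreal (c * norm (G (\<gamma> T) - G (\<gamma> 0))) \<le> kobayashi_length U \<gamma>"
        proof (rule kobayashi_length_ge [OF \<gamma>(1) T(1) \<open>c > 0\<close>])
          fix t assume "t \<in> {0..T}"
          then show "(G has_derivative G' (\<gamma> t)) (at (\<gamma> t))"
            unfolding G_def G'_def using pos \<open>\<kappa> \<noteq> 0\<close>
            by (auto intro!: derivative_eq_intros simp: divide_simps)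
        next
          fix t \<xi> assume t: "t \<in> {0<..<T}"
          have "c * norm (G' (\<gamma> t) \<xi>) \<le> c * (norm (\<xi> / \<kappa>) / Im (\<gamma> t / \<kappa>))"
            unfolding G'_def using \<open>c > 0\<close> pos [of t] t abs_Im_le_cmod [of "\<xi> / \<kappa>"]
            by (intro mult_left_mono) (auto simp: divide_right_mono)
          also have "\<dots> \<le> kobayashi_metric U (\<gamma> t) \<xi>"
            using low inU before t by auto
          finally show "c * norm (G' (\<gamma> t) \<xi>) \<le> kobayashi_metric U (\<gamma> t) \<xi>" .
        qed
        moreover have "ln (b / \<eta>) \<le> norm (G (\<gamma> T) - G (\<gamma> 0))"
        proof -
          \<comment> \<open>The height falls from \<open>\<eta>\<close> to \<open>\<eta>^2\<close>,
            and 2 \<open>ln \<eta>\<close> minus \<open>ln \<eta>\<close> remains. Its modulus is at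
            least \<open>ln (b / \<eta>)\<close> because \<open>b\<close> is below 1.\<close>
          have "G (\<gamma> T) - G (\<gamma> 0) = ln \<eta>"
            unfolding G_def start Im using \<open>0 < \<eta>\<close> by (simp add: ln_realpow)
          moreover have "ln (b / \<eta>) = ln b - ln \<eta>" using \<open>0 < \<eta>\<close> \<open>\<eta> < b\<close> by (simp add: ln_div)
          moreover have "ln b \<le> 0" using \<open>0 < \<eta>\<close> \<open>\<eta> < b\<close> \<open>b \<le> 1/2\<close> by simp
          ultimately show ?thesis by simp
        qed
        ultimately show ?thesis
          using \<open>c > 0\<close> by (meson ennreal_leI mult_left_mono order_trans less_imp_le)
      next
        assume b: "norm (\<gamma> T / \<kappa> - 1) = b"
        \<comment> \<open>The height never exceeds the distance to 1, so the metric also dominates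
          the derivative of this logarithm. Up to time \<open>T\<close> the curve stays above the
          real axis, away from the branch cut, and the real part alone grows from
          \<open>ln \<eta>\<close> to \<open>ln b\<close>.\<close>
        define G where "G = (\<lambda>z. Ln (z / \<kappa> - 1))"
        define G' where "G' = (\<lambda>z \<xi>. (1 / (z / \<kappa> - 1) * (1 / \<kappa>)) * \<xi>)"
        have "ennreal (c * norm (G (\<gamma> T) - G (\<gamma> 0))) \<le> kobayashi_length U \<gamma>"
        proof (rule kobayashi_length_ge [OF \<gamma>(1) T(1) \<open>c > 0\<close>])
          fix t assume "t \<in> {0..T}"
          then have "Im (\<gamma> t / \<kappa> - 1) > 0" using pos by simp
          then have "\<gamma> t / \<kappa> - 1 \<notin> \<real>\<^sub>\<le>\<^sub>0" by (auto simp: complex_nonpos_Reals_iff)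
          then have "(G has_field_derivative 1 / (\<gamma> t / \<kappa> - 1) * (1 / \<kappa>)) (at (\<gamma> t))"
            unfolding G_def using \<open>\<kappa> \<noteq> 0\<close> by (auto intro!: derivative_eq_intros simp: field_simps)
          then show "(G has_derivative G' (\<gamma> t)) (at (\<gamma> t))"
            unfolding has_field_derivative_def G'_def .
        next
          fix t \<xi> assume t: "t \<in> {0<..<T}"
          have p: "0 < Im (\<gamma> t / \<kappa>)" "Im (\<gamma> t / \<kappa>) \<le> norm (\<gamma> t / \<kappa> - 1)"
            using pos [of t] t abs_Im_le_cmod [of "\<gamma> t / \<kappa> - 1"] by auto
          have "norm (G' (\<gamma> t) \<xi>) = norm (\<xi> / \<kappa>) / norm (\<gamma> t / \<kappa> - 1)"
            by (simp add: G'_def norm_mult norm_divide)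
          also have "\<dots> \<le> norm (\<xi> / \<kappa>) / Im (\<gamma> t / \<kappa>)"
            using p by (intro divide_left_mono mult_pos_pos) auto
          finally have "c * norm (G' (\<gamma> t) \<xi>) \<le> c * (norm (\<xi> / \<kappa>) / Im (\<gamma> t / \<kappa>))"
            using \<open>c > 0\<close> by (intro mult_left_mono) auto
          also have "\<dots> \<le> kobayashi_metric U (\<gamma> t) \<xi>"
            using low inU before t by auto
          finally show "c * norm (G' (\<gamma> t) \<xi>) \<le> kobayashi_metric U (\<gamma> t) \<xi>" .
        qed
        moreover have "ln (b / \<eta>) \<le> norm (G (\<gamma> T) - G (\<gamma> 0))"
        proof -
          have "\<gamma> T / \<kappa> - 1 \<noteq> 0" using b \<open>0 < \<eta>\<close> \<open>\<eta> < b\<close> by auto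
          then have "Re (G (\<gamma> T) - G (\<gamma> 0)) = ln b - ln \<eta>"
            unfolding G_def using \<open>0 < \<eta>\<close> by (simp add: start b norm_mult)
          also have "\<dots> = ln (b / \<eta>)" using \<open>0 < \<eta>\<close> \<open>\<eta> < b\<close> by (simp add: ln_div)
          finally show ?thesis using complex_Re_le_cmod by metis
        qed
        ultimately show ?thesis
          using \<open>c > 0\<close> by (meson ennreal_leI mult_left_mono order_trans less_imp_le)
      qed
      then show "ennreal (ln (b / \<eta>) / (2 * B)) \<le> kobayashi_length U \<gamma>"
        by (simp add: c_def)
    qed
  qed
qed

subsection \<open>Half-planes at a parabolic fixed point\<close>

text \<open>Cesaro averaging: after subtracting \<open>k * l\<close>, the increments are eventually
  below \<open>r / 2\<close>, and division by a large index absorbs the initial part.\<close>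

lemma tendsto_average_of_increments:
  fixes x :: "nat \<Rightarrow> complex"
  assumes "(\<lambda>k. x (Suc k) - x k) \<longlonglongrightarrow> l"
  shows "(\<lambda>k. x k / of_nat k) \<longlonglongrightarrow> l"
proof (rule LIMSEQ_I)
  fix r :: real assume "r > 0"
  define y where "y k = x k - of_nat k * l" for k
  obtain K where K: "\<And>k. k \<ge> K \<Longrightarrow> norm (x (Suc k) - x k - l) < r / 2"
    using LIMSEQ_D [OF assms, of "r/2"] \<open>r > 0\<close> by auto
  have step: "norm (y (Suc k) - y k) \<le> r / 2" if "k \<ge> K" for k
    using K [OF that] by (simp add: y_def algebra_simps)
  have y: "norm (y k) \<le> norm (y K) + real (k - K) * (r / 2)" if "k \<ge> K" for k
    using that
  proof (induction k rule: dec_induct)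
    case (step k)
    have "norm (y (Suc k)) \<le> norm (y k) + norm (y (Suc k) - y k)"
      by (metis add.commute diff_add_cancel norm_triangle_ineq)
    then show ?case
      using step \<open>\<And>k. k \<ge> K \<Longrightarrow> norm (y (Suc k) - y k) \<le> r / 2\<close> [of k]
      by (simp add: Suc_diff_le algebra_simps add_divide_distrib diff_divide_distrib)
  qed auto
  obtain N where N: "real N > norm (y K) / (r / 2)"
    using reals_Archimedean2 by blast
  show "\<exists>no. \<forall>n\<ge>no. norm (x n / of_nat n - l) < r"
  proof (intro exI allI impI)
    fix n assume n: "n \<ge> max (Suc K) N"
    then have "n > 0" by auto
    have "norm (y n) \<le> norm (y K) + real n * (r / 2)"
      using y [of n] n \<open>r > 0\<close> by (auto intro: order_trans mult_right_mono)
    also have "norm (y K) < real N * (r / 2)"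
      using N \<open>r > 0\<close> by (simp add: pos_divide_less_eq)
    also have "real N * (r / 2) \<le> real n * (r / 2)"
      using n \<open>r > 0\<close> by (intro mult_right_mono) auto
    finally have "norm (y n) < real n * r" by (simp add: mult.commute)
    moreover have "x n / of_nat n - l = y n / of_nat n"
      using \<open>n > 0\<close> by (simp add: y_def field_simps)
    ultimately show "norm (x n / of_nat n - l) < r"
      using \<open>n > 0\<close> by (simp add: norm_divide field_simps)
  qed
qed

text \<open>\<open>chart m V\<close> parametrises a sector of opening \<open>\<pi> / m\<close> at \<open>0\<close> around the direction \<open>V\<close> by the
  right half-plane, through \<open>V w\<^bsup>-1/m\<^esup>\<close>. With \<open>V\<close> an attraction vector this is the usual coordinate
  \<open>-1 / (m a z\<^bsup>m\<^esup>)\<close>; with \<open>V\<close> rotated away from it, the same orbits are seen in a tilted half-plane.\<close>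

definition chart :: "nat \<Rightarrow> complex \<Rightarrow> complex \<Rightarrow> complex" where
  "chart m V w = V * exp (- Ln w / of_nat m)"

lemma chart_nonzero: "V \<noteq> 0 \<Longrightarrow> chart m V w \<noteq> 0"
  by (simp add: chart_def)

lemma chart_power:
  assumes "m \<ge> 1" "w \<noteq> 0"
  shows "chart m V w ^ m = V ^ m / w"
proof -
  have "exp (- Ln w / of_nat m) ^ m = exp (- Ln w)"
    using assms by (simp flip: exp_of_nat_mult)
  then show ?thesis using assms by (simp add: chart_def power_mult_distrib exp_minus field_simps)
qed

lemma norm_chart:
  assumes "w \<noteq> 0"
  shows "norm (chart m V w) = norm V * exp (- (ln (norm w) / real m))"
proof -
  have "Re (Ln w / of_nat m) = ln (norm w) / real m"
    using assms by (metis Re_Ln Re_divide_of_nat)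
  then show ?thesis by (simp add: chart_def norm_mult)
qed

text \<open>Homogeneity of degree \<open>-1/m\<close>: it turns the normalised orbit in
  \<open>converges_from_direction\<close> into averages \<open>x k / k\<close> of the
  coordinate.\<close>

lemma chart_scaled_root:
  assumes "m \<ge> 1" "k > 0" "w \<noteq> 0"
  shows "of_real (root m k) * chart m V w = chart m V (w / of_real k)"
proof -
  have "root m k = exp (ln k / real m)"
    using assms by (simp add: root_powr_inverse powr_def)
  then have "complex_of_real (root m k) = exp (of_real (ln k) / of_nat m)"
    by (simp add: exp_of_real [symmetric])
  moreover have "Ln (w / of_real k) = Ln w - of_real (ln k)"
    using assms by (simp add: Ln_divide_of_real)
  ultimately show ?thesis
    by (simp add: chart_def exp_add [symmetric] diff_divide_distrib)
qed

lemma isCont_chart: "m \<ge> 1 \<Longrightarrow> w \<notin> \<real>\<^sub>\<le>\<^sub>0 \<Longrightarrow> isCont (chart m V) w"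
  unfolding chart_def by (intro continuous_intros) auto

lemma tendsto_chart_at_infinity:
  assumes "m \<ge> 1"
  shows "(chart m V \<longlongrightarrow> 0) at_infinity"
proof (rule tendsto_norm_zero_cancel)
  have "filterlim (\<lambda>w::complex. ln (norm w) / real m) at_top at_infinity"
    unfolding divide_inverse using assms
    by (intro filterlim_at_top_mult_tendsto_pos [OF tendsto_const] filterlim_compose [OF ln_at_top] filterlim_norm_at_top) auto
  then have "((\<lambda>w::complex. norm V * exp (- (ln (norm w) / real m))) \<longlongrightarrow> norm V * 0) at_infinity"
    by (intro tendsto_mult tendsto_const filterlim_compose [OF exp_at_bot])
       (simp add: filterlim_uminus_at_bot)
  moreover have "\<forall>\<^sub>F w::complex in at_infinity. norm V * exp (- (ln (norm w) / real m)) = norm (chart m V w)"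
    using eventually_not_equal_at_infinity [of 0] by eventually_elim (simp add: norm_chart)
  ultimately show "((\<lambda>w. norm (chart m V w)) \<longlongrightarrow> 0) at_infinity"
    by (simp add: filterlim_cong)
qed

lemma filterlim_chart_at_0:
  assumes "m \<ge> 1" "V \<noteq> 0"
  shows "filterlim (chart m V) (at 0) at_infinity"
  using tendsto_chart_at_infinity [OF assms(1), of V] chart_nonzero [OF assms(2)]
  by (simp add: filterlim_at)

text \<open>Write \<open>f z = z * (1 + u)\<close>. Since \<open>z ^ m = V ^ m / w\<close>, the
  product \<open>w * u\<close> tends to \<open>V ^ m * a\<close>, and the new coordinate
  \<open>w / (1 + u) ^ m\<close> is \<open>w - m * w * u\<close> up to o(1). \<open>V\<close> stays
  free so that the lemma serves tilted half-planes and, applied to the local inverse, the repelling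
  direction.\<close>

lemma parabolic_chart_step:
  assumes m: "m \<ge> 1" and f: "((\<lambda>z. (f z - z) / z ^ (m + 1)) \<longlongrightarrow> a) (at 0)" and V: "V \<noteq> 0"
  obtains T where "((\<lambda>w. T w - w) \<longlongrightarrow> - (of_nat m * a * V ^ m)) at_infinity"
    "\<forall>\<^sub>F w in at_infinity. Re w > 0 \<longrightarrow> f (chart m V w) = chart m V (T w)"
proof -
  define u where "u w = (f (chart m V w) - chart m V w) / chart m V w" for w
  define T where "T w = w * inverse ((1 + u w) ^ m)" for w
  have nz: "\<forall>\<^sub>F w::complex in at_infinity. w \<noteq> 0"
    by (rule eventually_not_equal_at_infinity)
  have wu: "((\<lambda>w. w * u w) \<longlongrightarrow> V ^ m * a) at_infinity"
  proof (rule Lim_transform_eventually)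
    show "((\<lambda>w. V ^ m * ((f (chart m V w) - chart m V w) / chart m V w ^ (m + 1))) \<longlongrightarrow> V ^ m * a) at_infinity"
      by (intro tendsto_mult tendsto_const filterlim_compose [OF f filterlim_chart_at_0] m V)
    show "\<forall>\<^sub>F w in at_infinity. V ^ m * ((f (chart m V w) - chart m V w) / chart m V w ^ (m + 1)) = w * u w"
      using nz
    proof eventually_elim
      case (elim w)
      have "w = V ^ m / chart m V w ^ m"
        using chart_power [OF m elim, of V] V elim by (simp add: field_simps chart_nonzero)
      then have "w * u w = V ^ m / chart m V w ^ m * u w" by (rule arg_cong)
      then show ?case by (simp add: u_def mult_ac)
    qed
  qed
  have u0: "(u \<longlongrightarrow> 0) at_infinity"
  proof (rule Lim_transform_eventually)
    show "((\<lambda>w. (w * u w) * inverse w) \<longlongrightarrow> 0) at_infinity"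
      using tendsto_mult [OF wu tendsto_inverse_0] by simp
    show "\<forall>\<^sub>F w in at_infinity. w * u w * inverse w = u w"
      using nz by eventually_elim simp
  qed
  have "((\<lambda>x::complex. inverse ((1 + x) ^ m)) has_field_derivative - of_nat m) (at 0)"
    by (auto intro!: derivative_eq_intros)
  \<comment> \<open>Caratheodory's form of the derivative: the slope \<open>E\<close> is continuous
    at 0, so points with \<open>u w = 0\<close> need no separate treatment.\<close>
  then obtain E :: "complex \<Rightarrow> complex" where E0: "\<forall>x. inverse ((1 + x) ^ m) - inverse ((1 + 0) ^ m) = E x * (x - 0)"
      and E: "isCont E 0" "E 0 = - of_nat m"
    unfolding CARAT_DERIV by blast
  show ?thesis
  proof
    have "((\<lambda>w. (w * u w) * E (u w)) \<longlongrightarrow> (V ^ m * a) * E 0) at_infinity"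
      by (intro tendsto_mult wu isCont_tendsto_compose [OF E(1) u0])
    moreover have "(w * u w) * E (u w) = T w - w" for w
    proof -
      have "T w - w = w * (inverse ((1 + u w) ^ m) - 1)" by (simp add: T_def algebra_simps)
      then show ?thesis using E0 by simp
    qed
    ultimately show "((\<lambda>w. T w - w) \<longlongrightarrow> - (of_nat m * a * V ^ m)) at_infinity"
      by (simp add: E(2) mult_ac)
  next
    have u1: "((\<lambda>w. 1 + u w) \<longlongrightarrow> 1) at_infinity"
      using tendsto_add [OF tendsto_const u0, of 1] by simp
    have "((\<lambda>w. Ln (1 + u w)) \<longlongrightarrow> Ln 1) at_infinity"
      by (intro tendsto_Ln u1) auto
    then have "\<forall>\<^sub>F w in at_infinity. norm (Ln (1 + u w)) < pi / 2 / real m"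
      using m by (auto dest!: tendstoD [where e = "pi / 2 / real m"] simp: dist_norm)
    moreover have "\<forall>\<^sub>F w in at_infinity. norm (1 + u w - 1) < 1"
      using tendstoD [OF u1, of 1] by (simp add: dist_norm)
    ultimately show "\<forall>\<^sub>F w in at_infinity. Re w > 0 \<longrightarrow> f (chart m V w) = chart m V (T w)"
    proof eventually_elim
      case (elim w)
      show ?case
      proof
        assume "Re w > 0"
        then have w: "w \<noteq> 0" by auto
        with \<open>Re w > 0\<close> have Im_w: "\<bar>Im (Ln w)\<bar> < pi / 2"
          using Re_Ln_pos_lt by blast
        let ?L = "Ln (1 + u w)"
        have "1 + u w \<noteq> 0" using elim by (auto simp: add_eq_0_iff)
        then have eL: "exp ?L = 1 + u w" by simp
        have "real m * \<bar>Im ?L\<bar> \<le> real m * norm ?L"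
          by (intro mult_left_mono abs_Im_le_cmod) auto
        also have "\<dots> < pi / 2" using elim m by (simp add: field_simps)
        finally have "\<bar>real m * Im ?L\<bar> < pi / 2" by (simp add: abs_mult)
        \<comment> \<open>Branch control: both arguments are below \<open>pi / 2\<close>, so the
          difference of the logarithms is again a principal logarithm and \<open>chart\<close>
          selects the correct root.\<close>
        with Im_w have "\<bar>Im (Ln w - of_nat m * ?L)\<bar> < pi" by simp
        then have "Ln (exp (Ln w - of_nat m * ?L)) = Ln w - of_nat m * ?L"
          by (intro Ln_exp) auto
        moreover have "exp (Ln w - of_nat m * ?L) = T w"
          using w by (simp add: exp_diff exp_of_nat_mult eL T_def divide_inverse)
        ultimately have "chart m V (T w) = V * exp (- (Ln w - of_nat m * ?L) / of_nat m)"
          by (simp add: chart_def)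
        also have "- (Ln w - of_nat m * ?L) / of_nat m = - Ln w / of_nat m + ?L"
          using m by (simp add: field_simps)
        also have "V * exp \<dots> = chart m V w * (1 + u w)"
          by (simp only: exp_add eL chart_def mult.assoc)
        also have "\<dots> = f (chart m V w)"
          using chart_nonzero [OF V, of m w] by (simp add: u_def field_simps)
        finally show "f (chart m V w) = chart m V (T w)" ..
      qed
    qed
  qed
qed

text \<open>Far to the right, each step gains at least \<open>Re l / 2\<close> in real part, so the
  half-plane is invariant and the coordinate grows like \<open>k * l\<close>. By homogeneity the
  orbit has direction \<open>chart m V l\<close>, whose \<open>m\<close>-th power is
  \<open>V ^ m / l = -1 / (m * a)\<close>: an attraction vector even when \<open>V\<close> is
  none.\<close>

lemma parabolic_half_plane:
  assumes m: "m \<ge> 1" and f: "((\<lambda>z. (f z - z) / z ^ (m + 1)) \<longlongrightarrow> a) (at 0)" and V: "V \<noteq> 0"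
    and l: "l = - (of_nat m * a * V ^ m)" "Re l > 0"
  obtains M where "M > 0"
    "\<And>w. Re w > M \<Longrightarrow> converges_from_direction m (chart m V l) (\<lambda>k. (f ^^ k) (chart m V w))"
    "\<And>w k. Re w > M \<Longrightarrow> \<exists>w'. Re w' \<ge> Re w \<and> (f ^^ k) (chart m V w) = chart m V w'"
proof -
  obtain T where T: "((\<lambda>w. T w - w) \<longlongrightarrow> l) at_infinity"
    "\<forall>\<^sub>F w in at_infinity. Re w > 0 \<longrightarrow> f (chart m V w) = chart m V (T w)"
    by (rule parabolic_chart_step [OF m f V, folded l(1)])
  have "\<forall>\<^sub>F w in at_infinity. norm (T w - w - l) < Re l / 2"
    using tendstoD [OF T(1), of "Re l / 2"] l by (simp add: dist_norm)
  with T(2) have "\<forall>\<^sub>F w in at_infinity. (Re w > 0 \<longrightarrow> f (chart m V w) = chart m V (T w)) \<and>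
      norm (T w - w - l) < Re l / 2"
    by (rule eventually_conj)
  then obtain M0 where M0: "\<And>w. norm w \<ge> M0 \<Longrightarrow> (Re w > 0 \<longrightarrow> f (chart m V w) = chart m V (T w)) \<and>
      norm (T w - w - l) < Re l / 2"
    by (auto simp: eventually_at_infinity)
  define M where "M = max M0 1"
  have step: "f (chart m V w) = chart m V (T w)" "Re (T w) \<ge> Re w + Re l / 2" if "Re w > M" for w
  proof -
    have "norm w \<ge> M0" "Re w > 0"
      using that complex_Re_le_cmod [of w] by (auto simp: M_def)
    then show "f (chart m V w) = chart m V (T w)" "Re (T w) \<ge> Re w + Re l / 2"
      using M0 [of w] abs_Re_le_cmod [of "T w - w - l"] by auto
  qed
  have orbit: "(f ^^ k) (chart m V w) = chart m V ((T ^^ k) w) \<and> Re ((T ^^ k) w) \<ge> Re w + real k * (Re l / 2)"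
    if "Re w > M" for w k
  proof (induction k)
    case (Suc k)
    have "Re ((T ^^ k) w) > M"
      using Suc that l(2) by (smt (verit) mult_nonneg_nonneg of_nat_0_le_iff field_sum_of_halves)
    from step [OF this] Suc show ?case by (simp add: algebra_simps add_divide_distrib)
  qed auto
  show ?thesis
  proof
    show "M > 0" by (simp add: M_def)
  next
    fix w k assume "Re w > M"
    then show "\<exists>w'. Re w' \<ge> Re w \<and> (f ^^ k) (chart m V w) = chart m V w'"
      using orbit [of w k] l(2) by (smt (verit) mult_nonneg_nonneg of_nat_0_le_iff field_sum_of_halves)
  next
    fix w assume w: "Re w > M"
    define x where "x k = (T ^^ k) w" for k
    have x: "(f ^^ k) (chart m V w) = chart m V (x k)" "Re (x k) \<ge> Re w + real k * (Re l / 2)" for k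
      using orbit [OF w, of k] by (auto simp: x_def)
    have x_pos: "Re (x k) > 0" for k
      using x(2) [of k] w l(2) by (smt (verit) M_def mult_nonneg_nonneg of_nat_0_le_iff field_sum_of_halves)
    have "filterlim (\<lambda>k. Re w + real k * (Re l / 2)) at_top sequentially"
      by (intro filterlim_tendsto_add_at_top [OF tendsto_const] filterlim_at_top_mult_tendsto_pos [OF tendsto_const] filterlim_real_sequentially)
         (use l(2) in auto)
    then have "filterlim (\<lambda>k. norm (x k)) at_top sequentially"
      by (rule filterlim_at_top_mono)
         (intro always_eventually allI order_trans [OF x(2) complex_Re_le_cmod])
    then have x_inf: "filterlim x at_infinity sequentially"
      by (simp add: filterlim_norm_at_top_imp_at_infinity)
    have "(\<lambda>k. x (Suc k) - x k) \<longlonglongrightarrow> l"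
      using filterlim_compose [OF T(1) x_inf] by (simp add: x_def)
    then have avg: "(\<lambda>k. x k / of_nat k) \<longlonglongrightarrow> l"
      by (rule tendsto_average_of_increments)
    have "l \<notin> \<real>\<^sub>\<le>\<^sub>0" using l(2) by (auto simp: complex_nonpos_Reals_iff)
    then have "(\<lambda>k. chart m V (x k / of_nat k)) \<longlonglongrightarrow> chart m V l"
      by (intro isCont_tendsto_compose [OF isCont_chart [OF m] avg])
    moreover have "\<forall>\<^sub>F k in sequentially. chart m V (x k / of_nat k) = of_real (root m (real k)) * chart m V (x k)"
      using eventually_gt_at_top [of 0]
    proof eventually_elim
      case (elim k)
      then show ?case
        using chart_scaled_root [OF m, of "real k" "x k" V] x_pos [of k] by fastforce
    qed
    ultimately have "(\<lambda>k. of_real (root m (real k)) * chart m V (x k)) \<longlonglongrightarrow> chart m V l"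
      by (rule Lim_transform_eventually)
    moreover have "(\<lambda>k. chart m V (x k)) \<longlonglongrightarrow> 0"
      by (rule filterlim_compose [OF tendsto_chart_at_infinity [OF m] x_inf])
    ultimately show "converges_from_direction m (chart m V l) (\<lambda>k. (f ^^ k) (chart m V w))"
      unfolding converges_from_direction_def x(1) by (simp add: chart_nonzero V)
  qed
qed

lemma chart_exp:
  assumes "\<bar>Im \<zeta>\<bar> < pi"
  shows "chart m V (exp \<zeta>) = V * exp (- \<zeta> / of_nat m)"
  using assms by (simp add: chart_def Ln_exp)

lemma chart_1 [simp]: "chart m V 1 = V"
  by (simp add: chart_def)

lemma chart_linear: "w \<noteq> 0 \<Longrightarrow> chart (Suc 0) V w = V / w"
  by (simp add: chart_def exp_minus divide_inverse)

lemma connected_chart_half_plane: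
  assumes "m \<ge> 1" "M \<ge> 0"
  shows "connected (chart m V ` {w. Re w > M})"
proof (rule connected_continuous_image)
  have "w \<notin> \<real>\<^sub>\<le>\<^sub>0" if "Re w > M" for w
    using that assms by (auto simp: complex_nonpos_Reals_iff)
  then show "continuous_on {w. Re w > M} (chart m V)"
    using assms by (intro continuous_at_imp_continuous_on) (auto intro: isCont_chart)
  show "connected {w. Re w > M}"
    by (intro convex_connected convex_halfspace_Re_gt)
qed

text \<open>The passage back from asymptotics to the coordinate. With \<open>s k\<close> the
  normalised orbit divided by \<open>V\<close>, the coordinate is \<open>k\<close> times the
  \<open>-m\<close>-th power of \<open>s k\<close>; as \<open>s k\<close> tends to 1, its real part
  eventually exceeds \<open>k / 2\<close>.\<close>

lemma eventually_in_chart_half_plane: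
  assumes m: "m \<ge> 1" and V: "V \<noteq> 0" and z: "(\<lambda>k. of_real (root m (real k)) * z k) \<longlonglongrightarrow> V"
  shows "\<forall>\<^sub>F k in sequentially. \<exists>w. Re w > M \<and> z k = chart m V w"
proof -
  define s where "s k = of_real (root m (real k)) * z k / V" for k
  have "(\<lambda>k. of_real (root m (real k)) * z k / V) \<longlonglongrightarrow> V / V"
    using V by (intro tendsto_divide z tendsto_const) auto
  then have s: "s \<longlonglongrightarrow> 1" unfolding s_def using V by simp
  have L: "(\<lambda>k. - of_nat m * Ln (s k)) \<longlonglongrightarrow> - of_nat m * Ln 1"
    by (intro tendsto_intros s) auto
  then have "\<forall>\<^sub>F k in sequentially. norm (- of_nat m * Ln (s k)) < pi"
    by (auto dest!: tendstoD [where e = pi] simp: dist_norm)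
  moreover have "(\<lambda>k. Re (exp (- of_nat m * Ln (s k)))) \<longlonglongrightarrow> Re (exp (- of_nat m * Ln 1))"
    by (intro tendsto_Re tendsto_exp L)
  then have "\<forall>\<^sub>F k in sequentially. Re (exp (- of_nat m * Ln (s k))) > 1/2"
    by (rule order_tendstoD) simp
  moreover have "\<forall>\<^sub>F k in sequentially. norm (s k - 1) < 1"
    using tendstoD [OF s, of 1] by (simp add: dist_norm)
  moreover have "\<forall>\<^sub>F k in sequentially. real k > max 0 (2 * M)"
    using filterlim_real_sequentially by (simp add: filterlim_at_top_dense del: max_less_iff_conj)
  ultimately show ?thesis
  proof eventually_elim
    case (elim k)
    have "k > 0" using elim by auto
    let ?\<zeta> = "of_real (ln (real k)) + - of_nat m * Ln (s k)"
    have "exp (complex_of_real (ln (real k))) = of_real (exp (ln (real k)))"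
      by (rule exp_of_real)
    then have e: "exp ?\<zeta> = of_nat k * exp (- of_nat m * Ln (s k))"
      using \<open>k > 0\<close> unfolding exp_add by simp
    have "Re (exp ?\<zeta>) = real k * Re (exp (- of_nat m * Ln (s k)))"
      unfolding e by simp
    also have "\<dots> \<ge> real k * (1/2)"
      using elim by (intro mult_left_mono) auto
    finally have "Re (exp ?\<zeta>) > M" using elim by auto
    have "\<bar>Im ?\<zeta>\<bar> < pi"
      using abs_Im_le_cmod [of "- of_nat m * Ln (s k)"] elim by simp
    then have "chart m V (exp ?\<zeta>) = V * exp (- ?\<zeta> / of_nat m)"
      by (rule chart_exp)
    also have "- ?\<zeta> / of_nat m = - of_real (ln (real k) / real m) + Ln (s k)"
      using m by (simp add: field_simps)
    also have "exp \<dots> = s k / of_real (root m (real k))"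
    proof -
      have "s k \<noteq> 0" using elim by auto
      moreover have "root m (real k) = exp (ln (real k) / real m)"
        using m \<open>k > 0\<close> by (simp add: root_powr_inverse powr_def)
      ultimately show ?thesis
        by (simp only: exp_add exp_minus exp_of_real exp_Ln) (simp add: divide_inverse)
    qed
    also have "V * \<dots> = z k"
      using V m \<open>k > 0\<close> by (simp add: s_def)
    finally show ?case using \<open>Re (exp ?\<zeta>) > M\<close> by metis
  qed
qed

section \<open>Half-planes inside the immediate basin\<close>

lemma attraction_vector_nonzero: "attraction_vector m a v \<Longrightarrow> m \<ge> 1 \<Longrightarrow> v \<noteq> 0"
  by (auto simp: attraction_vector_def power_0_left)

text \<open>In the coordinate of \<open>v\<close> itself this is the right half-plane turned by
  \<open>\<theta>\<close>; a shift by 1 still maps it into itself because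
  \<open>cos \<theta> > 0\<close>. For \<open>\<theta>\<close> close to \<open>pi / 2\<close> it
  reaches almost down to the negative axis from above.\<close>

lemma tilted_half_plane:
  assumes m: "m \<ge> 1" and f: "((\<lambda>z. (f z - z) / z ^ (m + 1)) \<longlongrightarrow> a) (at 0)"
    and v: "attraction_vector m a v" and \<theta>: "\<bar>\<theta>\<bar> < pi / 2"
  obtains M where "M > 0"
    "\<And>w. Re w > M \<Longrightarrow> chart m (v * exp (- \<i> * of_real \<theta> / of_nat m)) w \<in> parabolic_basin f m v"
    "\<And>w k. Re w > M \<Longrightarrow> \<exists>w'. Re w' \<ge> Re w \<and> (f ^^ k) (chart m (v * exp (- \<i> * of_real \<theta> / of_nat m)) w)
       = chart m (v * exp (- \<i> * of_real \<theta> / of_nat m)) w'"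
proof -
  let ?V = "v * exp (- \<i> * of_real \<theta> / of_nat m)"
  have "?V \<noteq> 0" using attraction_vector_nonzero [OF v m] by simp
  have "exp (- \<i> * of_real \<theta> / of_nat m) ^ m = exp (- \<i> * of_real \<theta>)"
    using m by (simp flip: exp_of_nat_mult)
  then have "- (of_nat m * a * ?V ^ m) = - (of_nat m * a * v ^ m) * exp (- \<i> * of_real \<theta>)"
    by (simp add: power_mult_distrib)
  also have "\<dots> = exp (- \<i> * of_real \<theta>)"
    using v by (simp add: attraction_vector_def)
  finally have l: "exp (- \<i> * of_real \<theta>) = - (of_nat m * a * ?V ^ m)" ..
  have "chart m ?V (exp (- \<i> * of_real \<theta>)) = ?V * exp (- (- \<i> * of_real \<theta>) / of_nat m)"
    using \<theta> by (intro chart_exp) auto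
  also have "\<dots> = v" by (simp add: exp_minus)
  finally have c: "chart m ?V (exp (- \<i> * of_real \<theta>)) = v" .
  have "Re (exp (- \<i> * of_real \<theta>)) > 0"
    using \<theta> by (simp add: Re_exp cos_gt_zero_pi)
  from parabolic_half_plane [OF m f \<open>?V \<noteq> 0\<close> l this] obtain M where "M > 0"
    "\<And>w. Re w > M \<Longrightarrow> converges_from_direction m v (\<lambda>k. (f ^^ k) (chart m ?V w))"
    "\<And>w k. Re w > M \<Longrightarrow> \<exists>w'. Re w' \<ge> Re w \<and> (f ^^ k) (chart m ?V w) = chart m ?V w'"
    unfolding c by metis
  then show ?thesis
    by (intro that [of M]) (auto simp: parabolic_basin_def)
qed

text \<open>An orbit starting in \<open>\<Omega>\<close> stays there and eventually enters the
  half-plane, which is a connected part of the basin and hence lies in the same component.\<close>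

lemma half_plane_in_immediate_basin:
  assumes m: "m \<ge> 1" and f: "((\<lambda>z. (f z - z) / z ^ (m + 1)) \<longlongrightarrow> a) (at 0)"
    and v: "attraction_vector m a v" and \<Omega>: "is_immediate_basin f m v \<Omega>"
  obtains M where "M > 0" "chart m v ` {w. Re w > M} \<subseteq> \<Omega>"
proof -
  from \<Omega> have comp: "\<Omega> \<in> components (parabolic_basin f m v)" and inv: "f ` \<Omega> \<subseteq> \<Omega>"
    by (auto simp: is_immediate_basin_def)
  obtain M where M: "M > 0" "\<And>w. Re w > M \<Longrightarrow> chart m v w \<in> parabolic_basin f m v"
    using tilted_half_plane [OF m f v, of 0] by auto metis
  obtain z where z: "z \<in> \<Omega>"
    using in_components_nonempty [OF comp] by auto
  then have "converges_from_direction m v (\<lambda>k. (f ^^ k) z)"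
    using in_components_subset [OF comp] by (auto simp: parabolic_basin_def)
  then have "(\<lambda>k. of_real (root m (real k)) * (f ^^ k) z) \<longlonglongrightarrow> v"
    by (auto simp: converges_from_direction_def)
  from eventually_happens [OF eventually_in_chart_half_plane [OF m attraction_vector_nonzero [OF v m] this, of M]]
  obtain k w where "Re w > M" "(f ^^ k) z = chart m v w" by auto
  moreover have "(f ^^ k) z \<in> \<Omega>"
    using z inv by (induction k) auto
  ultimately have "\<Omega> \<inter> chart m v ` {w. Re w > M} \<noteq> {}" by auto
  then have "chart m v ` {w. Re w > M} \<subseteq> \<Omega>"
    using M m by (intro components_maximal [OF comp connected_chart_half_plane]) auto
  with M show ?thesis by (intro that) auto
qed

lemma tilted_half_plane_in_immediate_basin:
  assumes m: "m \<ge> 1" and f: "((\<lambda>z. (f z - z) / z ^ (m + 1)) \<longlongrightarrow> a) (at 0)"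
    and v: "attraction_vector m a v" and \<Omega>: "is_immediate_basin f m v \<Omega>" and \<theta>: "\<bar>\<theta>\<bar> < pi / 2"
  obtains M where "M > 0"
    "\<And>w. Re w > M \<Longrightarrow> chart m (v * exp (- \<i> * of_real \<theta> / of_nat m)) w \<in> \<Omega>"
    "\<And>w k. Re w > M \<Longrightarrow> \<exists>w'. Re w' \<ge> Re w \<and> (f ^^ k) (chart m (v * exp (- \<i> * of_real \<theta> / of_nat m)) w)
       = chart m (v * exp (- \<i> * of_real \<theta> / of_nat m)) w'"
proof -
  let ?V = "v * exp (- \<i> * of_real \<theta> / of_nat m)"
  from \<Omega> have comp: "\<Omega> \<in> components (parabolic_basin f m v)"
    by (auto simp: is_immediate_basin_def)
  obtain M0 where M0: "M0 > 0" "chart m v ` {w. Re w > M0} \<subseteq> \<Omega>"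
    using half_plane_in_immediate_basin [OF m f v \<Omega>] by metis
  obtain M where M: "M > 0" "\<And>w. Re w > M \<Longrightarrow> chart m ?V w \<in> parabolic_basin f m v"
    "\<And>w k. Re w > M \<Longrightarrow> \<exists>w'. Re w' \<ge> Re w \<and> (f ^^ k) (chart m ?V w) = chart m ?V w'"
    using tilted_half_plane [OF m f v \<theta>] by metis
  have c: "cos (\<theta> / 2) > 0" using \<theta> by (intro cos_gt_zero_pi) auto
  \<comment> \<open>The two half-planes meet on the bisecting ray, seen at angle
    \<open>\<theta> / 2\<close> in one chart and \<open>-\<theta> / 2\<close> in the other;
    \<open>R\<close> puts the point deep enough in both.\<close>
  define R where "R = (max M0 M + 1) / cos (\<theta> / 2)"
  have R: "R > 0" "R * cos (\<theta> / 2) = max M0 M + 1" using M c by (auto simp: R_def)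
  let ?\<zeta> = "\<lambda>\<theta>. of_real (ln R) + \<i> * of_real (\<theta> / 2)"
  have Re: "Re (exp (?\<zeta> \<theta>)) = max M0 M + 1" "Re (exp (?\<zeta> (- \<theta>))) = max M0 M + 1"
    using R by (simp_all add: Re_exp)
  have "chart m v (exp (?\<zeta> \<theta>)) = v * exp (- ?\<zeta> \<theta> / of_nat m)"
    using \<theta> by (intro chart_exp) auto
  also have "- ?\<zeta> \<theta> / of_nat m = - \<i> * of_real \<theta> / of_nat m + - ?\<zeta> (- \<theta>) / of_nat m"
    using m by (simp add: field_simps)
  also have "v * exp \<dots> = ?V * exp (- ?\<zeta> (- \<theta>) / of_nat m)"
    by (simp only: exp_add mult.assoc)
  also have "\<dots> = chart m ?V (exp (?\<zeta> (- \<theta>)))"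
    using \<theta> by (intro chart_exp [symmetric]) auto
  finally have "chart m v (exp (?\<zeta> \<theta>)) = chart m ?V (exp (?\<zeta> (- \<theta>)))" .
  moreover have "chart m v (exp (?\<zeta> \<theta>)) \<in> \<Omega>"
    using M0(2) Re by auto
  moreover have "chart m ?V (exp (?\<zeta> (- \<theta>))) \<in> chart m ?V ` {w. Re w > M}"
    using Re by (intro imageI) simp
  ultimately have "\<Omega> \<inter> chart m ?V ` {w. Re w > M} \<noteq> {}" by auto
  then have "chart m ?V ` {w. Re w > M} \<subseteq> \<Omega>"
    using M m by (intro components_maximal [OF comp connected_chart_half_plane]) auto
  with M show ?thesis by (intro that [of M]) auto
qed

subsection \<open>Points outside the immediate basin\<close>

lemma attracting_petal_orbit:
  assumes "attracting_petal f m v P" "z \<in> P"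
  shows "(f ^^ k) z \<in> P"
  using assms by (induction k) (auto simp: attracting_petal_def)

text \<open>Openness is invisible in the asymptotic definition; the absorption property of a petal
  rewrites the basin as the union of the preimages of \<open>P\<close>.\<close>

lemma open_parabolic_basin:
  assumes P: "attracting_petal f m v P" and f: "continuous_on UNIV f"
  shows "open (parabolic_basin f m v)"
proof -
  have cont: "continuous_on UNIV (f ^^ k)" for k
    by (induction k) (auto intro: continuous_on_compose2 [OF f] simp: o_def)
  have "parabolic_basin f m v = (\<Union>k. (f ^^ k) -` P)"
  proof (intro equalityI subsetI)
    fix z assume "z \<in> (\<Union>k. (f ^^ k) -` P)"
    then obtain K where K: "(f ^^ K) z \<in> P" by auto
    have "(f ^^ k) z \<in> P" if "k \<ge> K" for k
      using attracting_petal_orbit [OF P K, of "k - K"] that by (simp flip: funpow_add [THEN fun_cong, unfolded o_def])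
    then show "z \<in> parabolic_basin f m v"
      using P by (auto simp: attracting_petal_def parabolic_basin_def)
  next
    fix z assume "z \<in> parabolic_basin f m v"
    then obtain K where "\<forall>k\<ge>K. (f ^^ k) z \<in> P"
      using P unfolding attracting_petal_def parabolic_basin_def by blast
    then show "z \<in> (\<Union>k. (f ^^ k) -` P)" by auto
  qed
  moreover have "open ((f ^^ k) -` P)" for k
    using P cont by (intro open_vimage) (auto simp: attracting_petal_def)
  ultimately show ?thesis by auto
qed

lemma converges_from_direction_unique:
  assumes "converges_from_direction m v z" "converges_from_direction m v' z"
  shows "v = v'"
  using assms by (auto simp: converges_from_direction_def intro: LIMSEQ_unique)

section \<open>Local inverse and the repelling direction\<close>

lemma tangent_to_identity_ratio:
  fixes f :: "complex \<Rightarrow> complex"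
  assumes m: "m \<ge> 1" and f: "((\<lambda>z. (f z - z) / z ^ (m + 1)) \<longlongrightarrow> a) (at 0)"
  shows "((\<lambda>z. f z / z) \<longlongrightarrow> 1) (at 0)"
proof (rule Lim_transform_eventually)
  have "((\<lambda>z. 1 + z ^ m * ((f z - z) / z ^ (m + 1))) \<longlongrightarrow> 1 + 0 ^ m * a) (at 0)"
    by (intro tendsto_intros f)
  then show "((\<lambda>z. 1 + z ^ m * ((f z - z) / z ^ (m + 1))) \<longlongrightarrow> 1) (at 0)"
    using m by (simp add: power_0_left)
  show "\<forall>\<^sub>F z in at 0. 1 + z ^ m * ((f z - z) / z ^ (m + 1)) = f z / z"
    using eventually_neq_at_within [of 0] by eventually_elim (simp add: field_simps)
qed

lemma tangent_to_identity_deriv: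
  fixes f :: "complex \<Rightarrow> complex"
  assumes m: "m \<ge> 1" and f: "((\<lambda>z. (f z - z) / z ^ (m + 1)) \<longlongrightarrow> a) (at 0)" and "f 0 = 0"
  shows "(f has_field_derivative 1) (at 0)"
  using tangent_to_identity_ratio [OF m f] \<open>f 0 = 0\<close> by (simp add: DERIV_def)

lemma tangent_to_identity_inverse:
  fixes f :: "complex \<Rightarrow> complex"
  assumes m: "m \<ge> 1" and f: "((\<lambda>z. (f z - z) / z ^ (m + 1)) \<longlongrightarrow> a) (at 0)" and "f 0 = 0"
    and hol: "f holomorphic_on N" and N: "open N" "0 \<in> N" "inj_on f N"
  obtains g r where "r > 0" "\<And>y. y \<in> ball 0 r \<Longrightarrow> f (g y) = y"
    "((\<lambda>y. (g y - y) / y ^ (m + 1)) \<longlongrightarrow> - a) (at 0)"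
proof -
  obtain g where g: "g holomorphic_on (f ` N)" "\<And>z. z \<in> N \<Longrightarrow> g (f z) = z"
    using holomorphic_has_inverse [OF hol N(1,3)] by metis
  have "open (f ` N)" by (rule open_mapping_thm3 [OF hol N(1,3)])
  moreover have "0 \<in> f ` N" using N \<open>f 0 = 0\<close> by force
  ultimately obtain r where r: "r > 0" "ball 0 r \<subseteq> f ` N" by (meson openE)
  have fg: "f (g y) = y" if "y \<in> ball 0 r" for y
    using that r g(2) by force
  have g0: "g 0 = 0" using g(2) [of 0] N \<open>f 0 = 0\<close> by simp
  have "isCont g 0"
    using g(1) \<open>open (f ` N)\<close> \<open>0 \<in> f ` N\<close>
    by (metis continuous_on_eq_continuous_at holomorphic_on_imp_continuous_on)
  then have "(g \<longlongrightarrow> 0) (at 0)" by (simp add: isCont_def g0)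
  have near: "\<forall>\<^sub>F y in at 0. y \<in> ball 0 r \<and> y \<noteq> 0"
    using \<open>r > 0\<close> by (auto simp: eventually_at dist_commute intro!: exI [of _ r])
  then have ne: "\<forall>\<^sub>F y in at 0. g y \<noteq> 0"
    by eventually_elim (use fg \<open>f 0 = 0\<close> in metis)
  with \<open>(g \<longlongrightarrow> 0) (at 0)\<close> have glim: "filterlim g (at 0) (at 0)"
    by (simp add: filterlim_at)
  \<comment> \<open>Substituting \<open>z = g y\<close>, so that \<open>f z = y\<close>, turns this
    quotient into \<open>(g y - y) / y ^ (m + 1)\<close>.\<close>
  have "((\<lambda>z. - ((f z - z) / z ^ (m + 1)) / (f z / z) ^ (m + 1)) \<longlongrightarrow> - a / 1 ^ (m + 1)) (at 0)"
    by (intro tendsto_intros f tangent_to_identity_ratio [OF m f]) auto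
  from filterlim_compose [OF this glim]
  have "((\<lambda>y. - ((f (g y) - g y) / g y ^ (m + 1)) / (f (g y) / g y) ^ (m + 1)) \<longlongrightarrow> - a) (at 0)"
    by simp
  moreover have "\<forall>\<^sub>F y in at 0. - ((f (g y) - g y) / g y ^ (m + 1)) / (f (g y) / g y) ^ (m + 1) = (g y - y) / y ^ (m + 1)"
    using near ne
  proof eventually_elim
    case (elim y)
    then have "f (g y) = y" using fg by blast
    with elim show ?case by (simp add: power_divide divide_simps)
  qed
  ultimately have "((\<lambda>y. (g y - y) / y ^ (m + 1)) \<longlongrightarrow> - a) (at 0)"
    by (rule Lim_transform_eventually)
  with r fg show ?thesis using that by blast
qed

text \<open>If \<open>m = 1\<close> and a punctured ball lay in the basin, some iterate would map a ball into itself;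
  having derivative \<open>1\<close> at \<open>0\<close>, it would be a rotation by the Schwarz lemma, against convergence to \<open>0\<close>.\<close>

lemma punctured_ball_not_in_basin:
  assumes f: "((\<lambda>z. (f z - z) / z\<^sup>2) \<longlongrightarrow> a) (at 0)" and f0: "f 0 = 0" and hol: "f holomorphic_on UNIV"
    and v: "attraction_vector 1 a v" and "\<rho> > 0"
  shows "\<exists>z. z \<noteq> 0 \<and> norm z < \<rho> \<and> z \<notin> parabolic_basin f 1 v"
proof (rule ccontr)
  assume "\<not> ?thesis"
  then have all: "z \<in> parabolic_basin f 1 v" if "z \<noteq> 0" "norm z < \<rho>" for z
    using that by auto
  have f': "((\<lambda>z. (f z - z) / z ^ (1 + 1)) \<longlongrightarrow> a) (at 0)"
    using f by (simp add: numeral_2_eq_2)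
  have "v \<noteq> 0" by (rule attraction_vector_nonzero [OF v]) simp
  define r where "r = \<rho> / 2"
  have r: "0 < r" "r < \<rho>" using \<open>\<rho> > 0\<close> by (auto simp: r_def)
  obtain M where M: "M > 0" "\<And>w k. Re w > M \<Longrightarrow> \<exists>w'. Re w' \<ge> Re w \<and> (f ^^ k) (chart 1 v w) = chart 1 v w'"
    using tilted_half_plane [OF _ f' v, of 0] by auto metis
  \<comment> \<open>The second bound makes every orbit that starts in \<open>W\<close> stay in the
    ball of radius \<open>r\<close>, since the chart is \<open>v / w\<close>.\<close>
  define M' where "M' = max M (norm v / r)"
  define W where "W = chart 1 v ` {w. Re w > M'}"
  have W_eq: "W = {z. z \<noteq> 0} \<inter> {z. z \<noteq> 0 \<and> Re (v / z) > M'}"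
  proof (intro equalityI subsetI)
    fix z assume "z \<in> W"
    then obtain w where w: "Re w > M'" "z = chart 1 v w" by (auto simp: W_def)
    then have "w \<noteq> 0" using M by (auto simp: M'_def)
    with w \<open>v \<noteq> 0\<close> show "z \<in> {z. z \<noteq> 0} \<inter> {z. z \<noteq> 0 \<and> Re (v / z) > M'}" by (simp add: chart_linear)
  next
    fix z assume z: "z \<in> {z. z \<noteq> 0} \<inter> {z. z \<noteq> 0 \<and> Re (v / z) > M'}"
    then have "chart 1 v (v / z) = z" using \<open>v \<noteq> 0\<close> by (simp add: chart_linear)
    with z show "z \<in> W" by (force simp: W_def)
  qed
  have "open ({z. z \<noteq> 0} \<inter> (\<lambda>z. Re (v / z)) -` {M'<..})"
    by (intro continuous_open_preimage continuous_intros open_Collect_neq) auto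
  moreover have "{z. z \<noteq> 0} \<inter> (\<lambda>z. Re (v / z)) -` {M'<..} = W" unfolding W_eq by auto
  ultimately have "open W" by simp
  have W_small: "norm ((f ^^ k) z) < r" if z: "z \<in> W" for z k
  proof -
    obtain w where w: "Re w > M'" "z = chart 1 v w" using z by (auto simp: W_def)
    then obtain w' where w': "Re w' \<ge> Re w" "(f ^^ k) z = chart 1 v w'"
      using M(2) [of w k] by (auto simp: M'_def)
    have "norm w' > norm v / r"
      using w w' complex_Re_le_cmod [of w'] by (auto simp: M'_def)
    moreover have "norm v / r > 0" using \<open>v \<noteq> 0\<close> r by simp
    ultimately have "norm v / norm w' < r" "w' \<noteq> 0"
      using r by (auto simp: divide_less_eq mult.commute)
    then show ?thesis unfolding w' by (simp add: chart_linear norm_divide)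
  qed
  have holk: "(f ^^ k) holomorphic_on UNIV" for k
  proof (induction k)
    case (Suc k)
    have "(f \<circ> (f ^^ k)) holomorphic_on UNIV"
      by (rule holomorphic_on_compose [OF Suc holomorphic_on_subset [OF hol]]) auto
    then show ?case by (simp only: funpow.simps)
  qed (simp add: id_def)
  then have cont: "continuous_on S (f ^^ k)" for k S
    by (meson continuous_on_subset holomorphic_on_imp_continuous_on subset_UNIV)
  have absorbed: "\<exists>k. (f ^^ k) z \<in> W" if "norm z = r" for z
  proof -
    have "z \<in> parabolic_basin f 1 v" using that r by (intro all) auto
    then have "(\<lambda>k. of_real (root 1 (real k)) * (f ^^ k) z) \<longlonglongrightarrow> v"
      by (auto simp: parabolic_basin_def converges_from_direction_def)
    from eventually_happens [OF eventually_in_chart_half_plane [OF _ \<open>v \<noteq> 0\<close> this, of M']]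
    show ?thesis by (auto simp: W_def)
  qed
  have "sphere 0 r \<subseteq> (\<Union>k. (f ^^ k) -` W)" using absorbed by auto
  moreover have "open ((f ^^ k) -` W)" for k
    using \<open>open W\<close> cont by (intro open_vimage)
  ultimately obtain F where F: "finite F" "sphere 0 r \<subseteq> (\<Union>k\<in>F. (f ^^ k) -` W)"
    using compactE_image [of "sphere 0 r" UNIV "\<lambda>k. (f ^^ k) -` W"] by auto
  \<comment> \<open>Compactness bounds the entry times into \<open>W\<close> along the circle, so
    one exponent serves all its points. \<open>Suc\<close> makes \<open>K\<close> positive, needed
    for the iterates \<open>n * K\<close> to be cofinal.\<close>
  define K where "K = Suc (Max (insert 0 F))"
  have sphere: "norm ((f ^^ K) z) < r" if z: "z \<in> sphere 0 r" for z
  proof -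
    obtain k where k: "k \<in> F" "(f ^^ k) z \<in> W" using F(2) z by auto
    have "k \<le> Max (insert 0 F)" using k(1) F(1) by (intro Max_ge) auto
    then have "k \<le> K" by (simp add: K_def)
    then have "(f ^^ K) z = (f ^^ (K - k)) ((f ^^ k) z)"
      by (metis funpow_add comp_apply le_add_diff_inverse2)
    with W_small [OF k(2)] show ?thesis by metis
  qed
  have "sphere (0::complex) r \<noteq> {}" using r by auto
  moreover have "continuous_on (sphere 0 r) (\<lambda>z. norm ((f ^^ K) z))"
    by (intro continuous_on_norm cont)
  ultimately obtain x where x: "x \<in> sphere 0 r" "\<And>z. z \<in> sphere 0 r \<Longrightarrow> norm ((f ^^ K) z) \<le> norm ((f ^^ K) x)"
    using continuous_attains_sup [OF compact_sphere] by blast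
  have into: "norm ((f ^^ K) z) < r" if "norm z < r" for z
  proof -
    have "norm ((f ^^ K) z) \<le> norm ((f ^^ K) x)"
    proof (rule maximum_modulus_frontier [where f = "f ^^ K" and S = "cball 0 r"])
      show "(f ^^ K) holomorphic_on interior (cball 0 r)" by (rule holomorphic_on_subset [OF holk]) auto
      show "continuous_on (closure (cball 0 r)) (f ^^ K)" by (rule cont)
    qed (use x that r in auto)
    with sphere [OF x(1)] show ?thesis by linarith
  qed
  have fk0: "(f ^^ k) 0 = 0" for k using f0 by (induction k) auto
  have der: "((f ^^ k) has_field_derivative 1) (at 0)" for k
  proof (induction k)
    case (Suc k)
    have "(f has_field_derivative 1) (at ((f ^^ k) 0))"
      using tangent_to_identity_deriv [OF _ f' f0] by (simp add: fk0)
    from DERIV_chain [OF this Suc] show ?case by (simp only: funpow.simps mult_1)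
  qed (simp add: id_def)
  define h where "h z = (f ^^ K) (of_real r * z) / of_real r" for z
  have "h holomorphic_on ball 0 1"
    unfolding h_def using r
    by (intro holomorphic_intros holomorphic_on_compose_gen [OF _ holk, unfolded o_def]) auto
  moreover have "h 0 = 0" by (simp add: h_def fk0)
  moreover have "norm (h z) < 1" if "norm z < 1" for z
    using into [of "of_real r * z"] that r by (simp add: h_def norm_mult norm_divide)
  moreover have "deriv h 0 = 1"
  proof -
    have "((\<lambda>z. (f ^^ K) (of_real r * z)) has_field_derivative 1 * of_real r) (at 0)"
      by (rule DERIV_chain2) (use der in \<open>auto intro!: derivative_eq_intros\<close>)
    then have "(h has_field_derivative 1 * of_real r / of_real r) (at 0)"
      unfolding h_def by (rule DERIV_cdivide)
    then show ?thesis using r by (simp add: DERIV_imp_deriv)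
  qed
  ultimately obtain \<alpha> where \<alpha>: "\<And>z. norm z < 1 \<Longrightarrow> h z = \<alpha> * z" "norm \<alpha> = 1"
    using Schwarz_Lemma(3) [of h 0] by auto
  have rot: "norm ((f ^^ K) z) = norm z" if "norm z < r" for z
  proof -
    have "h (z / of_real r) = \<alpha> * (z / of_real r)"
      using that r by (intro \<alpha>) (simp add: norm_divide)
    then have "(f ^^ K) z = \<alpha> * z" using r by (simp add: h_def)
    then show ?thesis using \<alpha> by (simp add: norm_mult)
  qed
  define z where "z = complex_of_real (r / 2)"
  have nz: "norm z = r / 2" using r by (simp add: z_def)
  have iter: "norm ((f ^^ (n * K)) z) = r / 2" for n
  proof (induction n)
    case (Suc n)
    then have "norm ((f ^^ K) ((f ^^ (n * K)) z)) = r / 2" using rot r by simp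
    then show ?case by (simp add: funpow_add)
  qed (simp add: nz)
  have "z \<in> parabolic_basin f 1 v" using nz r by (intro all) auto
  then have "(\<lambda>k. (f ^^ k) z) \<longlonglongrightarrow> 0"
    by (auto simp: parabolic_basin_def converges_from_direction_def)
  moreover have "filterlim (\<lambda>n. n * K) sequentially sequentially"
    by (rule mult_nat_right_at_top) (simp add: K_def)
  ultimately have "(\<lambda>n. (f ^^ (n * K)) z) \<longlonglongrightarrow> 0"
    by (rule filterlim_compose)
  then have "(\<lambda>n. norm ((f ^^ (n * K)) z)) \<longlonglongrightarrow> 0"
    by (rule tendsto_norm_zero)
  then have "r / 2 = 0" unfolding iter by (simp add: LIMSEQ_const_iff)
  with r show False by simp
qed

text \<open>If \<open>m = 1\<close>, the half-planes with normals at angles \<open>pi/3\<close>,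
  \<open>-pi/3\<close> and \<open>pi\<close> cover a neighbourhood of infinity in the coordinate
  \<open>v / z\<close>; if the last one lay in the basin as well, so would a punctured ball. If
  \<open>m > 1\<close>, the repelling half-plane overlaps a tilted half-plane of the next attraction
  vector, and an orbit has only one direction.\<close>

lemma repelling_half_plane_meets_complement:
  assumes m: "m \<ge> 1" and f: "((\<lambda>z. (f z - z) / z ^ (m + 1)) \<longlongrightarrow> a) (at 0)"
    and f0: "f 0 = 0" and hol: "f holomorphic_on UNIV" and v: "attraction_vector m a v"
  shows "\<exists>w. Re w > M \<and> chart m (v * exp (- \<i> * of_real pi / of_nat m)) w \<notin> parabolic_basin f m v"
proof (cases "m = 1")
  case True
  have "v \<noteq> 0" by (rule attraction_vector_nonzero [OF v m])
  have tilt: "\<exists>M. \<forall>w. Re w > M \<longrightarrow> chart m (v * exp (- \<i> * of_real \<theta> / of_nat m)) w \<in> parabolic_basin f m v"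
    if "\<bar>\<theta>\<bar> < pi / 2" for \<theta>
    using tilted_half_plane [OF m f v that] by metis
  obtain M1 where M1: "\<And>w. Re w > M1 \<Longrightarrow> chart m (v * exp (- \<i> * of_real (pi/3) / of_nat m)) w \<in> parabolic_basin f m v"
    using tilt [of "pi/3"] by auto
  obtain M2 where M2: "\<And>w. Re w > M2 \<Longrightarrow> chart m (v * exp (- \<i> * of_real (-pi/3) / of_nat m)) w \<in> parabolic_basin f m v"
    using tilt [of "-pi/3"] by auto
  define R where "R = Max {1, M, M1, M2}"
  have R: "R \<ge> 1" "R \<ge> M" "R \<ge> M1" "R \<ge> M2" by (auto simp: R_def)
  have exps: "exp (- \<i> * of_real (pi/3)) = Complex (1/2) (- sqrt 3 / 2)"
      "exp (- \<i> * of_real (- pi/3)) = Complex (1/2) (sqrt 3 / 2)" "exp (- \<i> * of_real pi) = -1"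
    by (simp_all add: complex_eq_iff Re_exp Im_exp cos_60 sin_60)
  show ?thesis
  proof (rule ccontr)
    assume "\<not> ?thesis"
    then have M: "\<And>w. Re w > M \<Longrightarrow> chart m (v * exp (- \<i> * of_real pi / of_nat m)) w \<in> parabolic_basin f m v"
      by auto
    have ch: "z \<in> parabolic_basin f m v"
      if "\<And>w. Re w > L \<Longrightarrow> chart m (v * exp (- \<i> * of_real \<theta> / of_nat m)) w \<in> parabolic_basin f m v"
        "Re (exp (- \<i> * of_real \<theta>) * (v / z)) > L" "z \<noteq> 0" for L \<theta> :: real and z :: complex
    proof -
      have "chart m (v * exp (- \<i> * of_real \<theta> / of_nat m)) (exp (- \<i> * of_real \<theta>) * (v / z)) = z"
        using that \<open>v \<noteq> 0\<close> True by (simp add: chart_linear)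
      with that(1) [OF that(2)] show ?thesis by simp
    qed
    define \<rho> where "\<rho> = norm v / (2 * R)"
    have "\<rho> > 0" using \<open>v \<noteq> 0\<close> R by (simp add: \<rho>_def)
    obtain z where z: "z \<noteq> 0" "norm z < \<rho>" "z \<notin> parabolic_basin f m v"
      using punctured_ball_not_in_basin [OF _ f0 hol _ \<open>\<rho> > 0\<close>, of a v] f v True
      by (auto simp: numeral_2_eq_2)
    define x where "x = v / z"
    have "norm x > 2 * R"
      using z R by (simp add: x_def \<rho>_def norm_divide field_simps)
    \<comment> \<open>The three opposite inequalities cut out an equilateral triangle with inradius
      \<open>R\<close>, hence circumradius \<open>2 * R\<close>.\<close>
    have "Re (exp (- \<i> * of_real (pi/3)) * x) > R \<or> Re (exp (- \<i> * of_real (-pi/3)) * x) > R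
        \<or> Re (exp (- \<i> * of_real pi) * x) > R"
    proof (rule ccontr)
      assume "\<not> ?thesis"
      then have le: "Re x / 2 + sqrt 3 / 2 * Im x \<le> R" "Re x / 2 - sqrt 3 / 2 * Im x \<le> R" "- Re x \<le> R"
        unfolding exps by (simp_all add: algebra_simps)
      have "sqrt 3 * \<bar>Im x\<bar> \<le> 2 * R - Re x"
        using le by (cases "Im x \<ge> 0") (auto simp: algebra_simps)
      then have "(sqrt 3 * \<bar>Im x\<bar>)\<^sup>2 \<le> (2 * R - Re x)\<^sup>2"
        by (intro power_mono) auto
      then have "3 * (Im x)\<^sup>2 \<le> (2 * R - Re x)\<^sup>2" by (simp add: power_mult_distrib)
      moreover have "Re x \<le> 2 * R" "- R \<le> Re x" using le by auto
      then have "(2 * R - Re x) * (Re x + R) \<ge> 0" by simp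
      ultimately have "(Re x)\<^sup>2 + (Im x)\<^sup>2 \<le> (2 * R)\<^sup>2"
        by (simp add: power2_eq_square algebra_simps)
      then have "norm x \<le> 2 * R"
        using R by (simp add: cmod_def real_le_lsqrt)
      with \<open>norm x > 2 * R\<close> show False by simp
    qed
    then show False
    proof (elim disjE)
      assume "Re (exp (- \<i> * of_real (pi/3)) * x) > R"
      with ch [where L = M1 and \<theta> = "pi/3" and z = z, OF M1] z R show False by (auto simp: x_def)
    next
      assume "Re (exp (- \<i> * of_real (-pi/3)) * x) > R"
      with ch [where L = M2 and \<theta> = "-pi/3" and z = z, OF M2] z R show False by (auto simp: x_def)
    next
      assume "Re (exp (- \<i> * of_real pi) * x) > R"
      with ch [where L = M and \<theta> = "pi" and z = z, OF M] z R show False by (auto simp: x_def)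
    qed
  qed
next
  case False
  define v' where "v' = v * exp (- \<i> * of_real (2 * pi) / of_nat m)"
  have "v \<noteq> 0" by (rule attraction_vector_nonzero [OF v m])
  have "exp (- \<i> * of_real (2 * pi) / of_nat m) ^ m = exp (- \<i> * of_real (2 * pi))"
    using m by (simp flip: exp_of_nat_mult)
  also have "\<dots> = 1" by (simp add: complex_eq_iff Re_exp Im_exp)
  finally have v'_att: "attraction_vector m a v'"
    using v by (simp add: attraction_vector_def v'_def power_mult_distrib)
  have "v \<noteq> v'"
  proof
    assume "v = v'"
    then have "exp (- \<i> * of_real (2 * pi) / of_nat m) = 1" using \<open>v \<noteq> 0\<close> by (simp add: v'_def)
    then obtain n :: int where "- (2 * pi) / real m = of_int (2 * n) * pi"
      by (auto simp: exp_eq_1)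
    then have "pi * (- 1) = pi * (real_of_int n * real m)" using m by (simp add: field_simps)
    then have "- 1 = real_of_int n * real m" by (rule mult_left_cancel [THEN iffD1, rotated]) simp
    then have "- 1 = n * int m" by (metis of_int_1 of_int_eq_iff of_int_minus of_int_mult of_int_of_nat_eq)
    then have "int m dvd 1" by (metis dvd_minus_iff dvd_triv_right)
    with False show False by simp
  qed
  obtain M' where M': "\<And>w. Re w > M' \<Longrightarrow>
      chart m (v' * exp (- \<i> * of_real (-pi/3) / of_nat m)) w \<in> parabolic_basin f m v'"
    using tilted_half_plane [OF m f v'_att, of "-pi/3"] by auto metis
  define R where "R = 2 * (max 0 (max M M') + 1)"
  have R: "R > 0" "R / 2 > M" "R / 2 > M'" by (auto simp: R_def)
  let ?\<zeta> = "\<lambda>\<theta>. of_real (ln R) + \<i> * of_real \<theta>"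
  have "Re (exp (?\<zeta> (pi/3))) = R / 2" "Re (exp (?\<zeta> (-pi/3))) = R / 2"
    using R by (simp_all add: Re_exp cos_60)
  then have Re: "Re (exp (?\<zeta> (pi/3))) > M" "Re (exp (?\<zeta> (-pi/3))) > M'" using R by auto
  have "chart m (v * exp (- \<i> * of_real pi / of_nat m)) (exp (?\<zeta> (pi/3)))
      = v * exp (- \<i> * of_real pi / of_nat m) * exp (- ?\<zeta> (pi/3) / of_nat m)"
    by (intro chart_exp) auto
  also have "\<dots> = v * exp (- \<i> * of_real pi / of_nat m + - ?\<zeta> (pi/3) / of_nat m)"
    by (simp only: exp_add mult.assoc)
  also have "- \<i> * of_real pi / of_nat m + - ?\<zeta> (pi/3) / of_nat m
      = - \<i> * of_real (2 * pi) / of_nat m + - \<i> * of_real (-pi/3) / of_nat m + - ?\<zeta> (-pi/3) / of_nat m"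
    using m by (simp add: field_simps)
  also have "v * exp \<dots> = v' * exp (- \<i> * of_real (-pi/3) / of_nat m) * exp (- ?\<zeta> (-pi/3) / of_nat m)"
    by (simp only: exp_add v'_def mult.assoc)
  also have "\<dots> = chart m (v' * exp (- \<i> * of_real (-pi/3) / of_nat m)) (exp (?\<zeta> (-pi/3)))"
    by (intro chart_exp [symmetric]) auto
  finally have "chart m (v * exp (- \<i> * of_real pi / of_nat m)) (exp (?\<zeta> (pi/3))) \<in> parabolic_basin f m v'"
    using M' [OF Re(2)] by simp
  with \<open>v \<noteq> v'\<close> have "chart m (v * exp (- \<i> * of_real pi / of_nat m)) (exp (?\<zeta> (pi/3))) \<notin> parabolic_basin f m v"
    by (auto simp: parabolic_basin_def dest: converges_from_direction_unique)
  with Re(1) show ?thesis by blast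
qed

lemma backward_orbit_in_complement:
  assumes m: "m \<ge> 1" and f: "((\<lambda>z. (f z - z) / z ^ (m + 1)) \<longlongrightarrow> a) (at 0)"
    and f0: "f 0 = 0" and hol: "f holomorphic_on UNIV" and v: "attraction_vector m a v"
    and N: "open N" "0 \<in> N" "inj_on f N"
    and \<Omega>: "\<Omega> \<subseteq> parabolic_basin f m v" "f ` \<Omega> \<subseteq> \<Omega>"
  obtains p where "\<And>n. p n \<notin> \<Omega>"
    "(\<lambda>n. of_real (root m (real n)) * p n) \<longlonglongrightarrow> v * exp (- \<i> * of_real pi / of_nat m)"
proof -
  let ?U = "v * exp (- \<i> * of_real pi / of_nat m)"
  have "?U \<noteq> 0" using attraction_vector_nonzero [OF v m] by simp
  have "f holomorphic_on N" by (rule holomorphic_on_subset [OF hol]) simp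
  obtain g r where r: "r > 0" and fg: "\<And>y. y \<in> ball 0 r \<Longrightarrow> f (g y) = y"
    and g: "((\<lambda>y. (g y - y) / y ^ (m + 1)) \<longlongrightarrow> - a) (at 0)"
    using tangent_to_identity_inverse [OF m f f0 \<open>f holomorphic_on N\<close> N] by metis
  have "exp (- \<i> * of_real pi / of_nat m) ^ m = exp (- \<i> * of_real pi)"
    using m by (simp flip: exp_of_nat_mult)
  also have "\<dots> = -1" by (simp add: complex_eq_iff Re_exp Im_exp)
  finally have "?U ^ m = - (v ^ m)" by (simp add: power_mult_distrib)
  \<comment> \<open>The sign changes of the coefficient and of \<open>?U ^ m\<close> cancel: the
    repelling direction of \<open>f\<close> is an attraction vector of \<open>g\<close>, with step
    1.\<close>
  then have "1 = - (of_nat m * (- a) * ?U ^ m)"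
    using v by (simp add: attraction_vector_def)
  from parabolic_half_plane [OF m g \<open>?U \<noteq> 0\<close> this] obtain M where M:
    "\<And>w. Re w > M \<Longrightarrow> converges_from_direction m ?U (\<lambda>k. (g ^^ k) (chart m ?U w))"
    "\<And>w k. Re w > M \<Longrightarrow> \<exists>w'. Re w' \<ge> Re w \<and> (g ^^ k) (chart m ?U w) = chart m ?U w'"
    by auto metis
  have "\<forall>\<^sub>F w in at_infinity. norm (chart m ?U w) < r"
    using tendstoD [OF tendsto_chart_at_infinity [OF m, of ?U] r] by simp
  then obtain M0 where M0: "\<And>w. norm w \<ge> M0 \<Longrightarrow> norm (chart m ?U w) < r"
    by (auto simp: eventually_at_infinity)
  obtain w where w: "Re w > max M M0" "chart m ?U w \<notin> parabolic_basin f m v"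
    using repelling_half_plane_meets_complement [OF m f f0 hol v] by blast
  define p where "p n = (g ^^ n) (chart m ?U w)" for n
  have "norm (p n) < r" for n
  proof -
    obtain w' where "Re w' \<ge> Re w" "p n = chart m ?U w'" using M(2) [of w n] w by (auto simp: p_def)
    then show ?thesis using M0 [of w'] w complex_Re_le_cmod [of w'] by auto
  qed
  then have pre: "f (p (Suc n)) = p n" for n
    using fg [of "p n"] by (simp add: p_def)
  have "p n \<notin> \<Omega>" for n
  proof (induction n)
    case 0
    show ?case using w \<Omega>(1) by (auto simp: p_def)
  next
    case (Suc n)
    then show ?case using pre [of n] \<Omega>(2) by (metis image_subset_iff)
  qed
  moreover have "(\<lambda>n. of_real (root m (real n)) * p n) \<longlonglongrightarrow> ?U"
    using M(1) [of w] w by (auto simp: converges_from_direction_def p_def)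
  ultimately show ?thesis using that by blast
qed

text \<open>At the scale \<open>\<kappa> = U / root m n\<close>, the points \<open>p\<^sub>k\<close> with \<open>k\<close> near \<open>n / t\<^bsup>m\<^esup>\<close> approximate \<open>t\<close>; a finite
  net of values \<open>t\<close> makes the approximation uniform.\<close>

lemma eventually_dense_at_scale:
  fixes p :: "nat \<Rightarrow> complex"
  assumes m: "m \<ge> 1" and "U \<noteq> 0" and p: "(\<lambda>n. of_real (root m (real n)) * p n) \<longlonglongrightarrow> U" and "\<epsilon> > 0"
  shows "\<forall>\<^sub>F n in sequentially. \<forall>t\<in>{1/2..2::real}. \<exists>k. norm (p k / (U / of_real (root m (real n))) - of_real t) < \<epsilon>"
proof -
  have point: "\<forall>\<^sub>F n in sequentially. \<exists>k. norm (p k / (U / of_real (root m (real n))) - of_real t) < \<epsilon> / 2"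
    if "t > 0" for t :: real
  proof -
    define c where "c = 1 / t ^ m"
    have "c > 0" using that by (simp add: c_def)
    define k where "k n = nat \<lfloor>c * real n\<rfloor>" for n
    have inf: "filterlim (\<lambda>n. c * real n) at_top sequentially"
      using \<open>c > 0\<close> by (intro filterlim_tendsto_pos_mult_at_top [OF tendsto_const] filterlim_real_sequentially)
    have kinf: "filterlim k at_top sequentially"
      unfolding k_def
      by (intro filterlim_compose [OF filterlim_nat_sequentially] filterlim_compose [OF filterlim_floor_sequentially] inf)
    have ratio: "(\<lambda>n. real (k n) / real n) \<longlonglongrightarrow> c"
    proof (rule tendsto_sandwich)
      show "(\<lambda>n. c - 1 / real n) \<longlonglongrightarrow> c" "(\<lambda>n. c) \<longlonglongrightarrow> c"
        by (auto intro!: tendsto_eq_intros lim_1_over_n)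
      have b: "real (k n) \<le> c * real n" "c * real n - 1 \<le> real (k n)" for n
        using \<open>c > 0\<close> by (auto simp: k_def)
      show "\<forall>\<^sub>F n in sequentially. real (k n) / real n \<le> c"
        using eventually_gt_at_top [of 0] by eventually_elim (use b in \<open>simp add: field_simps\<close>)
      show "\<forall>\<^sub>F n in sequentially. c - 1 / real n \<le> real (k n) / real n"
        using eventually_gt_at_top [of 0]
      proof eventually_elim
        case (elim n)
        then show ?case
          using divide_right_mono [OF b(2) [of n], of "real n"] by (simp add: diff_divide_distrib)
      qed
    qed
    have "(\<lambda>n. (of_real (root m (real (k n))) * p (k n)) / (U * of_real (root m (real (k n) / real n)))) \<longlonglongrightarrow>
        U / (U * of_real (root m c))"
      using m \<open>c > 0\<close> \<open>U \<noteq> 0\<close>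
      by (intro tendsto_intros filterlim_compose [OF p kinf] ratio) auto
    also have "U / (U * of_real (root m c)) = of_real t"
      using m that \<open>U \<noteq> 0\<close> by (simp add: c_def real_root_divide real_root_power_cancel)
    finally have lim: "(\<lambda>n. (of_real (root m (real (k n))) * p (k n)) / (U * of_real (root m (real (k n) / real n)))) \<longlonglongrightarrow> of_real t" .
    have "\<forall>\<^sub>F n in sequentially. norm ((of_real (root m (real (k n))) * p (k n)) / (U * of_real (root m (real (k n) / real n))) - of_real t) < \<epsilon> / 2"
      using tendstoD [OF lim, of "\<epsilon> / 2"] \<open>\<epsilon> > 0\<close> by (simp add: dist_norm)
    moreover have "\<forall>\<^sub>F n in sequentially. k n \<ge> 1"
      using kinf unfolding filterlim_at_top by blast
    ultimately show ?thesis
      using eventually_gt_at_top [of 0]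
    proof eventually_elim
      case (elim n)
      then have "root m (real (k n)) \<noteq> 0" "root m (real n) \<noteq> 0" using m by auto
      then have "(of_real (root m (real (k n))) * p (k n)) / (U * of_real (root m (real (k n) / real n)))
          = p (k n) / (U / of_real (root m (real n)))"
        using \<open>U \<noteq> 0\<close> by (simp add: real_root_divide field_simps)
      with elim show ?case by auto
    qed
  qed
  have cover: "{1/2..2::real} \<subseteq> (\<Union>t\<in>{1/2..2}. ball t (\<epsilon> / 2))" using \<open>\<epsilon> > 0\<close> by force
  obtain T where T: "finite T" "T \<subseteq> {1/2..2::real}" "{1/2..2} \<subseteq> (\<Union>t\<in>T. ball t (\<epsilon> / 2))"
    by (rule compactE_image [OF compact_Icc open_ball cover])
  have "\<forall>\<^sub>F n in sequentially. \<forall>t\<in>T. \<exists>k. norm (p k / (U / of_real (root m (real n))) - of_real t) < \<epsilon> / 2"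
    using T point by (intro eventually_ball_finite) auto
  then show ?thesis
  proof eventually_elim
    case (elim n)
    show ?case
    proof
      fix t :: real assume "t \<in> {1/2..2}"
      then obtain s where s: "s \<in> T" "\<bar>s - t\<bar> < \<epsilon> / 2" using T(3) by (auto simp: dist_real_def)
      then obtain k where k: "norm (p k / (U / of_real (root m (real n))) - of_real s) < \<epsilon> / 2"
        using elim by blast
      have "norm (complex_of_real s - of_real t) < \<epsilon> / 2"
        using s by (simp flip: of_real_diff)
      with k have "norm (p k / (U / of_real (root m (real n))) - of_real t) < \<epsilon>"
        using norm_triangle_ineq [of "p k / (U / of_real (root m (real n))) - of_real s" "of_real s - of_real t"]
        by simp
      then show "\<exists>k. norm (p k / (U / of_real (root m (real n))) - of_real t) < \<epsilon>" ..
    qed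
  qed
qed

subsection \<open>Points far from the grand orbit\<close>

text \<open>Injectivity cancels one application of \<open>f\<close> on each side until one exponent
  is 0.\<close>

lemma orbits_merge_inj:
  assumes "inj_on f N" "\<And>j. (f ^^ j) x \<in> N" "\<And>j. (f ^^ j) y \<in> N" "(f ^^ l) x = (f ^^ k) y"
  shows "(\<exists>j. (f ^^ j) x = y) \<or> (\<exists>j. x = (f ^^ j) y)"
  using assms(4)
proof (induction l arbitrary: k)
  case (Suc l)
  show ?case
  proof (cases k)
    case 0
    with Suc.prems show ?thesis by (metis funpow_0)
  next
    case (Suc k')
    with Suc.prems have "f ((f ^^ l) x) = f ((f ^^ k') y)" by simp
    then have "(f ^^ l) x = (f ^^ k') y" using assms(1-3) by (meson inj_onD)
    then show ?thesis by (rule Suc.IH)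
  qed
qed auto

text \<open>The usual coordinate of the point is \<open>-n\<close> divided by \<open>Z ^ m\<close>.
  Undoing the tilt leaves the argument \<open>pi / 2 + \<delta> - Im L\<close>, which is less than
  \<open>pi / 2 - \<delta>\<close>; this gives the factor \<open>sin \<delta>\<close>, while
  \<open>Re L < 1\<close> gives \<open>exp (-1)\<close>.\<close>

lemma repelling_scale_in_tilted_chart:
  fixes Z :: complex
  assumes m: "m \<ge> 1" and n: "n > 0" and Z: "Im Z > 0" "norm (of_nat m * Ln Z) < 1"
    and \<delta>: "0 < \<delta>" "2 * \<delta> < real m * Im (Ln Z)"
  obtains w where "Re w \<ge> real n * (exp (-1) * sin \<delta>)"
    "v * exp (- \<i> * of_real pi / of_nat m) / of_real (root m (real n)) * Z
       = chart m (v * exp (- \<i> * of_real (pi / 2 - \<delta>) / of_nat m)) w"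
proof -
  define L where "L = of_nat m * Ln Z"
  have L: "\<bar>Re L\<bar> < 1" "\<bar>Im L\<bar> < 1" "2 * \<delta> < Im L"
    using Z(2) \<delta>(2) abs_Re_le_cmod [of L] abs_Im_le_cmod [of L] by (auto simp: L_def)
  define \<zeta> where "\<zeta> = of_real (ln (real n)) + \<i> * of_real (pi / 2 + \<delta>) - L"
  have pi: "pi > 3" by (rule pi_gt3)
  have "sin \<delta> \<le> sin (Im L - \<delta>)"
    using L \<delta> pi by (intro sin_monotone_2pi_le) auto
  also have "\<dots> = cos (pi / 2 - (Im L - \<delta>))" by (simp add: cos_diff)
  also have "pi / 2 - (Im L - \<delta>) = Im \<zeta>" by (simp add: \<zeta>_def)
  finally have cos: "cos (Im \<zeta>) \<ge> sin \<delta>" .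
  have "sin \<delta> > 0" using L \<delta> pi by (intro sin_gt_zero) auto
  have "exp (Re \<zeta>) \<ge> exp (ln (real n) + (- 1))"
    using L by (simp add: \<zeta>_def)
  then have exp: "exp (Re \<zeta>) \<ge> real n * exp (- 1)"
    using n by (simp only: exp_add exp_ln of_nat_0_less_iff)
  have "real n * (exp (-1) * sin \<delta>) = (real n * exp (- 1)) * sin \<delta>" by simp
  also have "\<dots> \<le> exp (Re \<zeta>) * cos (Im \<zeta>)"
    using exp cos \<open>sin \<delta> > 0\<close> by (intro mult_mono) auto
  also have "\<dots> = Re (exp \<zeta>)" by (simp add: Re_exp)
  finally have Re: "Re (exp \<zeta>) \<ge> real n * (exp (-1) * sin \<delta>)" .
  have "chart m (v * exp (- \<i> * of_real (pi / 2 - \<delta>) / of_nat m)) (exp \<zeta>)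
      = v * exp (- \<i> * of_real (pi / 2 - \<delta>) / of_nat m) * exp (- \<zeta> / of_nat m)"
    using L \<delta> pi by (intro chart_exp) (auto simp: \<zeta>_def)
  also have "\<dots> = v * exp (- \<i> * of_real (pi / 2 - \<delta>) / of_nat m + - \<zeta> / of_nat m)"
    by (simp only: exp_add mult.assoc)
  also have "- \<i> * of_real (pi / 2 - \<delta>) / of_nat m + - \<zeta> / of_nat m
      = - \<i> * of_real pi / of_nat m + - of_real (ln (real n) / real m) + Ln Z"
    using m by (simp add: \<zeta>_def L_def field_simps)
  also have "exp \<dots> = exp (- \<i> * of_real pi / of_nat m) * inverse (exp (of_real (ln (real n) / real m))) * Z"
  proof -
    have "exp (Ln Z) = Z" using Z by (intro exp_Ln) auto
    then show ?thesis by (simp only: exp_add exp_minus)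
  qed
  also have "exp (of_real (ln (real n) / real m)) = complex_of_real (root m (real n))"
    using m n by (simp only: exp_of_real) (simp add: root_powr_inverse powr_def)
  finally show ?thesis
    by (intro that [OF Re]) (simp only: divide_inverse mult.assoc)
qed

theorem theoremC:
  fixes p h :: "complex poly" and m :: nat and a v q :: complex
    and \<Omega> P :: "complex set" and C :: real
  assumes "m \<ge> 1" and "a \<noteq> 0"
    and "p = [:0, 1:] + monom a (m + 1) + monom 1 (m + 2) * h"
    and "attraction_vector m a v"
    and "is_immediate_basin (poly p) m v \<Omega>"
    and "attracting_petal (poly p) m v P"
    and "C > 0"
    and "q \<in> P" and "q \<in> {of_real t * v | t. t > 0}"
  shows "\<exists>z0\<in>\<Omega>. \<forall>q'\<in>grand_orbit (poly p) q \<inter> \<Omega>. kobayashi_dist \<Omega> z0 q' \<ge> ennreal C"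
proof -
  note m = \<open>m \<ge> 1\<close> and v = \<open>attraction_vector m a v\<close> and \<Omega> = \<open>is_immediate_basin (poly p) m v \<Omega>\<close>
    and P = \<open>attracting_petal (poly p) m v P\<close>
  define f where "f = poly p"
  have f_eq: "f z = z + a * z ^ (m + 1) + z ^ (m + 2) * poly h z" for z
    by (simp add: f_def assms(3) poly_monom)
  have f0: "f 0 = 0" by (simp add: f_eq)
  have hol: "f holomorphic_on UNIV" unfolding f_def by (intro holomorphic_intros)
  have tangent: "((\<lambda>z. (f z - z) / z ^ (m + 1)) \<longlongrightarrow> a) (at 0)"
  proof (rule Lim_transform_eventually)
    have "((\<lambda>z. a + z * poly h z) \<longlongrightarrow> a + 0 * poly h 0) (at 0)"
      by (intro tendsto_intros)
    then show "((\<lambda>z. a + z * poly h z) \<longlongrightarrow> a) (at 0)" by simp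
    show "\<forall>\<^sub>F z in at 0. a + z * poly h z = (f z - z) / z ^ (m + 1)"
      using eventually_neq_at_within [of 0] by eventually_elim (simp add: f_eq field_simps)
  qed
  note \<Omega> = \<Omega> [folded f_def] and P = P [folded f_def]
  have comp: "\<Omega> \<in> components (parabolic_basin f m v)" and inv: "f ` \<Omega> \<subseteq> \<Omega>"
    using \<Omega> by (auto simp: is_immediate_basin_def)
  have "open \<Omega>"
    using comp open_parabolic_basin [OF P holomorphic_on_imp_continuous_on [OF hol]]
    by (rule open_components [rotated])
  obtain N where N: "open N" "0 \<in> N" "inj_on f N" "P \<subseteq> N"
    using P by (auto simp: attracting_petal_def)
  have "v \<noteq> 0" by (rule attraction_vector_nonzero [OF v m])
  let ?U = "v * exp (- \<i> * of_real pi / of_nat m)"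
  obtain pn where pn: "\<And>n. pn n \<notin> \<Omega>" "(\<lambda>n. of_real (root m (real n)) * pn n) \<longlonglongrightarrow> ?U"
    using backward_orbit_in_complement [OF m tangent f0 hol v N(1-3) in_components_subset [OF comp] inv] by metis

  obtain K :: real where "K > 0" and K:
    "\<And>U \<kappa> b \<eta> z'. \<lbrakk>open U; \<kappa> \<noteq> 0; 0 < \<eta>; \<eta> < b; b \<le> 1/2;
        \<And>t::real. t \<in> {1/2..2} \<Longrightarrow> \<exists>P. P \<notin> U \<and> norm (P / \<kappa> - of_real t) < \<eta>\<^sup>2 / 10;
        \<not> (norm (z' / \<kappa> - 1) < b \<and> \<eta>\<^sup>2 < Im (z' / \<kappa>))\<rbrakk>
      \<Longrightarrow> ennreal (ln (b / \<eta>) / K) \<le> kobayashi_dist U (\<kappa> * (1 + \<i> * of_real \<eta>)) z'"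
    using kobayashi_dist_near_dense_complement by metis

  have "((\<lambda>Z. of_nat m * Ln Z) \<longlongrightarrow> of_nat m * Ln 1) (nhds 1)"
    by (intro tendsto_intros) (auto simp: filterlim_ident)
  then have "\<forall>\<^sub>F Z in nhds 1. norm (of_nat m * Ln Z) < 1"
    by (auto dest!: tendstoD [where e = 1])
  then obtain b0 where b0: "b0 > 0" "\<And>Z. norm (Z - 1) < b0 \<Longrightarrow> norm (of_nat m * Ln Z) < 1"
    by (auto simp: eventually_nhds_metric dist_norm)
  define b where "b = min b0 (1/2)"
  have b: "b > 0" "b \<le> 1/2" "\<And>Z. norm (Z - 1) < b \<Longrightarrow> norm (of_nat m * Ln Z) < 1"
    using b0 by (auto simp: b_def)
  define \<eta> where "\<eta> = b * exp (- (K * C))"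
  have \<eta>: "0 < \<eta>" "\<eta> < b" "ln (b / \<eta>) / K = C"
    using b \<open>K > 0\<close> \<open>C > 0\<close> by (auto simp: \<eta>_def exp_minus field_simps)
  define R where "R = {Z. norm (Z - 1) < b \<and> \<eta>\<^sup>2 < Im Z}"
  \<comment> \<open>For \<open>Z\<close> in \<open>R\<close> the modulus is below 2, so the argument
    of \<open>Z\<close> is at least its sine and exceeds \<open>\<eta>^2 / 2\<close>; multiplied by
    \<open>m\<close>, this is \<open>2 * \<delta>\<close>.\<close>
  define \<delta> where "\<delta> = real m * \<eta>\<^sup>2 / 4"
  have "\<delta> > 0" using m \<eta> by (simp add: \<delta>_def)
  have R: "Im Z > 0" "norm (of_nat m * Ln Z) < 1" "2 * \<delta> < real m * Im (Ln Z)" if "Z \<in> R" for Z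
  proof -
    have Z: "norm (Z - 1) < b" "\<eta>\<^sup>2 < Im Z" using that by (auto simp: R_def)
    show "Im Z > 0" using Z \<eta> by (smt (verit) zero_le_power2)
    then have "Z \<noteq> 0" "0 < Im (Ln Z)" by (auto simp: Im_Ln_pos_lt_imp)
    show "norm (of_nat m * Ln Z) < 1" using b(3) Z by blast
    have "norm Z < 2"
      using Z b norm_triangle_ineq [of "Z - 1" 1] by simp
    have "Im Z = norm Z * sin (Im (Ln Z))"
      using \<open>Z \<noteq> 0\<close> by (metis Im_exp Re_Ln exp_Ln exp_ln zero_less_norm_iff)
    also have "\<dots> \<le> norm Z * Im (Ln Z)"
      using \<open>0 < Im (Ln Z)\<close> by (intro mult_left_mono sin_x_le_x) auto
    also have "\<dots> \<le> 2 * Im (Ln Z)"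
      using \<open>norm Z < 2\<close> \<open>0 < Im (Ln Z)\<close> by (intro mult_right_mono) auto
    finally have "\<eta>\<^sup>2 / 2 < Im (Ln Z)" using Z by simp
    then have "real m * (\<eta>\<^sup>2 / 2) < real m * Im (Ln Z)" using m by (intro mult_strict_left_mono) auto
    then show "2 * \<delta> < real m * Im (Ln Z)" by (simp add: \<delta>_def)
  qed
  have "\<eta>\<^sup>2 < \<eta>" using \<eta> b by (simp add: power2_eq_square)
  then have start: "1 + \<i> * of_real \<eta> \<in> R" using \<eta> by (simp add: R_def norm_mult)
  have "\<delta> < 1 / 2"
    using R(2,3) [OF start] abs_Im_le_cmod [of "of_nat m * Ln (1 + \<i> * of_real \<eta>)"] by simp
  with \<open>\<delta> > 0\<close> have \<theta>: "\<bar>pi / 2 - \<delta>\<bar> < pi / 2" using pi_gt3 by simp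
  let ?V = "v * exp (- \<i> * of_real (pi / 2 - \<delta>) / of_nat m)"
  obtain M1 where M1: "\<And>w. Re w > M1 \<Longrightarrow> chart m ?V w \<in> \<Omega>"
    "\<And>w k. Re w > M1 \<Longrightarrow> \<exists>w'. Re w' \<ge> Re w \<and> (f ^^ k) (chart m ?V w) = chart m ?V w'"
    using tilted_half_plane_in_immediate_basin [OF m tangent v \<Omega> \<theta>] by metis

  have qP: "(f ^^ k) q \<in> P" for k
    by (rule attracting_petal_orbit [OF P \<open>q \<in> P\<close>])
  then have "converges_from_direction m v (\<lambda>k. (f ^^ k) q)"
    using P by (auto simp: attracting_petal_def)
  then have q_nz: "\<And>k. (f ^^ k) q \<noteq> 0" and q_lim: "(\<lambda>k. of_real (root m (real k)) * (f ^^ k) q) \<longlonglongrightarrow> v"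
    by (auto simp: converges_from_direction_def)
  \<comment> \<open>The \<open>m\<close>-th power of \<open>z / v\<close> is the reciprocal of the
    usual coordinate, so a positive real part means lying on the attracting side.\<close>
  have "(\<lambda>k. Re ((of_real (root m (real k)) * (f ^^ k) q / v) ^ m)) \<longlonglongrightarrow> Re ((v / v) ^ m)"
    using \<open>v \<noteq> 0\<close> by (intro tendsto_intros q_lim)
  then have "\<forall>\<^sub>F k in sequentially. 0 < Re ((of_real (root m (real k)) * (f ^^ k) q / v) ^ m)"
    by (rule order_tendstoD) (use \<open>v \<noteq> 0\<close> in simp)
  then have "\<forall>\<^sub>F k in sequentially. 0 < Re (((f ^^ k) q / v) ^ m)"
  proof eventually_elim
    case (elim k)
    have "(of_real (root m (real k)) * (f ^^ k) q / v) ^ m = of_nat k * ((f ^^ k) q / v) ^ m"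
      using m by (simp add: power_mult_distrib power_divide flip: of_real_power)
    with elim show ?case by (simp add: zero_less_mult_iff)
  qed
  then obtain k0 where k0: "\<And>k. k \<ge> k0 \<Longrightarrow> 0 < Re (((f ^^ k) q / v) ^ m)"
    by (auto simp: eventually_sequentially)
  define y where "y = (f ^^ k0) q"
  obtain r where r: "r > 0" "ball 0 r \<subseteq> N" using N by (meson openE)
  \<comment> \<open>The bound \<open>r\<close> will keep the orbit of \<open>q'\<close> where
    \<open>f\<close> is injective; the bound \<open>norm y\<close> will prevent it from hitting
    \<open>y\<close>.\<close>
  have "min (norm y) r > 0" using r q_nz by (simp add: y_def)
  from tendstoD [OF tendsto_chart_at_infinity [OF m, of ?V] this]
  obtain M2 where M2: "\<And>w. norm w \<ge> M2 \<Longrightarrow> norm (chart m ?V w) < min (norm y) r"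
    by (auto simp: eventually_at_infinity)

  have "sin \<delta> > 0" using \<open>\<delta> > 0\<close> \<open>\<delta> < 1/2\<close> pi_gt3 by (intro sin_gt_zero) auto
  then have "filterlim (\<lambda>n. real n * (exp (-1) * sin \<delta>)) at_top sequentially"
    by (intro filterlim_at_top_mult_tendsto_pos [OF tendsto_const] filterlim_real_sequentially) simp
  then have "\<forall>\<^sub>F n in sequentially. max M1 M2 < real n * (exp (-1) * sin \<delta>)"
    unfolding filterlim_at_top_dense by blast
  moreover have "\<forall>\<^sub>F n in sequentially. \<forall>t\<in>{1/2..2::real}.
      \<exists>k. norm (pn k / (?U / of_real (root m (real n))) - of_real t) < \<eta>\<^sup>2 / 10"
    using \<open>v \<noteq> 0\<close> \<eta> by (intro eventually_dense_at_scale m pn(2)) auto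
  ultimately have "\<forall>\<^sub>F n in sequentially. n > 0 \<and> max M1 M2 < real n * (exp (-1) * sin \<delta>) \<and>
      (\<forall>t\<in>{1/2..2::real}. \<exists>k. norm (pn k / (?U / of_real (root m (real n))) - of_real t) < \<eta>\<^sup>2 / 10)"
    using eventually_gt_at_top [of 0] by eventually_elim auto
  then obtain n where n: "n > 0" "max M1 M2 < real n * (exp (-1) * sin \<delta>)"
    and dense: "\<And>t::real. t \<in> {1/2..2} \<Longrightarrow> \<exists>k. norm (pn k / (?U / of_real (root m (real n))) - of_real t) < \<eta>\<^sup>2 / 10"
    by (auto simp: eventually_sequentially)
  define \<kappa> where "\<kappa> = ?U / of_real (root m (real n))"
  have "\<kappa> \<noteq> 0" using \<open>v \<noteq> 0\<close> m n by (simp add: \<kappa>_def)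
  have in_chart: "\<exists>w. Re w > max M1 M2 \<and> \<kappa> * Z = chart m ?V w" if "Z \<in> R" for Z
    using repelling_scale_in_tilted_chart [OF m n(1) R(1,2) [OF that] \<open>\<delta> > 0\<close> R(3) [OF that], of v] n(2)
    unfolding \<kappa>_def by (metis order_less_le_trans)

  show ?thesis
  proof (intro bexI ballI)
    show "\<kappa> * (1 + \<i> * of_real \<eta>) \<in> \<Omega>"
      using in_chart [OF start] M1(1) by auto
  next
    fix q' assume "q' \<in> grand_orbit (poly p) q \<inter> \<Omega>"
    then obtain l k where lk: "(f ^^ l) q' = (f ^^ k) q"
      by (auto simp: grand_orbit_def f_def)
    have "q' / \<kappa> \<notin> R"
    proof
      assume Z: "q' / \<kappa> \<in> R"
      then obtain w where w: "Re w > max M1 M2" "q' = chart m ?V w"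
        using in_chart \<open>\<kappa> \<noteq> 0\<close> by (metis nonzero_mult_div_cancel_left times_divide_eq_right)
      have small: "norm ((f ^^ j) q') < min (norm y) r" for j
      proof -
        obtain w' where w': "Re w' \<ge> Re w" "(f ^^ j) q' = chart m ?V w'"
          using M1(2) [of w j] w by auto
        then show ?thesis using M2 [of w'] w complex_Re_le_cmod [of w'] by auto
      qed
      \<comment> \<open>Adding \<open>k0\<close> steps replaces \<open>q\<close> by the late iterate
        \<open>y\<close>, so that a merge can only place \<open>q'\<close> among iterates of index
        at least \<open>k0\<close>.\<close>
      have "(f ^^ (k0 + l)) q' = (f ^^ k) y"
        by (metis lk y_def add.commute comp_apply funpow_add)
      moreover have "(f ^^ j) q' \<in> N" for j using small [of j] r by auto
      moreover have "(f ^^ j) y \<in> N" for j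
        using qP [of "j + k0"] N by (auto simp: y_def funpow_add)
      ultimately consider j where "(f ^^ j) q' = y" | j where "q' = (f ^^ j) y"
        using orbits_merge_inj [OF N(3)] by metis
      then show False
      proof cases
        case 1
        with small [of j] show False by simp
      next
        case 2
        then have "q' = (f ^^ (j + k0)) q" by (simp add: y_def funpow_add)
        then have pos: "0 < Re ((q' / v) ^ m)" using k0 by simp
        define Z where "Z = q' / \<kappa>"
        have "Z \<noteq> 0" using R(1) [OF Z] by (auto simp: Z_def)
        have "exp (- \<i> * of_real pi / of_nat m) ^ m = exp (- \<i> * of_real pi)"
          using m by (simp flip: exp_of_nat_mult)
        also have "\<dots> = -1" by (simp add: complex_eq_iff Re_exp Im_exp)
        finally have e: "exp (- \<i> * of_real pi / of_nat m) ^ m = -1" .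
        \<comment> \<open>The contradiction is one of signs: \<open>Z ^ m\<close> has argument below
          1 and so positive real part, and this factor puts \<open>q'\<close> on the repelling
          side.\<close>
        have "(\<kappa> / v) ^ m = - 1 / of_nat n"
          unfolding \<kappa>_def using \<open>v \<noteq> 0\<close> m e by (simp add: power_divide power_mult_distrib flip: of_real_power)
        moreover have "q' / v = (\<kappa> / v) * Z" using \<open>\<kappa> \<noteq> 0\<close> by (simp add: Z_def)
        then have "(q' / v) ^ m = (\<kappa> / v) ^ m * Z ^ m" by (simp only: power_mult_distrib)
        ultimately have "(q' / v) ^ m = - (Z ^ m / of_nat n)" by simp
        with pos n have "Re (Z ^ m) < 0" by (simp add: divide_less_0_iff)
        moreover have "Z ^ m = exp (of_nat m * Ln Z)"
          using \<open>Z \<noteq> 0\<close> by (simp add: exp_of_nat_mult)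
        moreover have "\<bar>Im (of_nat m * Ln Z)\<bar> < 1"
          using R(2) [OF Z] abs_Im_le_cmod [of "of_nat m * Ln Z"] by (simp add: Z_def)
        then have "cos (Im (of_nat m * Ln Z)) > 0"
          using pi_gt3 by (intro cos_gt_zero_pi) auto
        ultimately show False by (simp add: Re_exp mult_less_0_iff)
      qed
    qed
    then have "ennreal (ln (b / \<eta>) / K) \<le> kobayashi_dist \<Omega> (\<kappa> * (1 + \<i> * of_real \<eta>)) q'"
      using dense pn(1)
      by (intro K \<open>open \<Omega>\<close> \<open>\<kappa> \<noteq> 0\<close> \<eta> b) (auto simp: R_def \<kappa>_def)
    then show "kobayashi_dist \<Omega> (\<kappa> * (1 + \<i> * of_real \<eta>)) q' \<ge> ennreal C"
      by (simp only: \<eta>(3))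
  qed
qed

end
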